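(* The following are examples of Lipschitz-free rigid Prague spaces: (1) uniformly concave metric spaces; (2) $3$-connected graphs $(V,E)$ endowed with the graph metric.
   Context: For a metric space $(\mathcal{M},d)$, let $\mathcal{F}_0(\mathcal{M})$ be the real vector space of finitely supported functions $x:\mathcal{M}\to\mathbb{R}$ with $\sum_{m}x(m)=0$, normed by $\|x\|=\sup\{|\sum_m x(m)f(m)| : f:\mathcal{M}\to\mathbb{R}\text{ is }1\text{-Lipschitz}\}$. The Lipschitz-free space $\mathcal{F}(\mathcal{M})$ is its completion. For $x\neq y$ put $m_{x,y}=(\chi_{\{x\}}-\chi_{\{y\}})/d(x,y)\in\mathcal{F}(\mathcal{M})$. $E_{ext}(\mathcal{M})$ is the (symmetric) set of ordered pairs $(x,y)$ of distinct points such that $m_{x,y}$ is an extreme point of the closed unit ball of $\mathcal{F}(\mathcal{M})^{**}$; $V_{ext}(\mathcal{M})$ is the set of points incident with such pairs. $\mathcal{M}$ is a Prague space if $V_{ext}(\mathcal{M})$ is dense in $\mathcal{M}$, the graph $(V_{ext}(\mathcal{M}),E_{ext}(\mathcal{M}))$ is connected, and for all $x,y\in V_{ext}(\mathcal{M})$ the distance $d(x,y)$ equals the infimum of $\sum_{i=1}^k d(x_{i-1},x_i)$ over all finite sequences $x=x_0,\dots,x_k=y$ with $(x_{i-1},x_i)\in E_{ext}(\mathcal{M})$. $\mathcal{M}$ is uniformly concave if for every $x\neq y\in\mathcal{M}$ and $\varepsilon>0$ there is $\delta>0$ such that $d(x,z)+d(z,y)-\delta>d(x,y)$ for all $z\in\mathcal{M}$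 with $\min\{d(x,z),d(y,z)\}\ge\varepsilon$. Graphs may be infinite and have no loops or multiple edges; the graph metric on a connected graph is the length of a shortest path. A graph is $n$-connected if upon removing $n-1$ vertices it remains connected (so $3$-connected means that it remains connected upon removing two vertices); the one-vertex graph counts as connected. A map $g:\mathcal{M}\to\mathcal{M}$ is an $a$-dilation ($a>0$) if $d(x,y)=a\,d(g(x),g(y))$ for all $x,y$. $\mathcal{M}$ is Lipschitz-free rigid if for every surjective linear isometry $T$ of $\mathcal{F}(\mathcal{M})$ onto itself there exist $\varepsilon\in\{\pm1\}$, $a>0$ and a surjective $a$-dilation $g:\mathcal{M}\to\mathcal{M}$ such that $T(m_{x,y})=\varepsilon m_{g(x),g(y)}$ for all $x\neq y$ in $\mathcal{M}$.
   Formalization: Spaces and graphs are assumed to have at least two points; rigidity in (1) is proved for complete spaces only (it fails for [0,1) with metric |x-y|^{1/2}); 3-connected means connected after removing at most two vertices, which excludes the three-vertex path, where rigidity fails. *)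

theory Defs
  imports "HOL-Analysis.Analysis" "HOL-Library.Function_Algebras"
begin

instantiation "fun" :: (type, real_vector) real_vector
begin

definition scaleR_fun :: "real \<Rightarrow> ('a \<Rightarrow> 'b) \<Rightarrow> 'a \<Rightarrow> 'b"
  where "scaleR_fun c f = (\<lambda>x. c *\<^sub>R f x)"

instance
  by standard (simp_all add: scaleR_fun_def fun_eq_iff algebra_simps)

end

lemma scaleR_fun_apply [simp]: "(c *\<^sub>R f) x = c *\<^sub>R f x"
  by (simp add: scaleR_fun_def)


subsection \<open>Duals and isometries of normed spaces with an explicit carrier\<close>

text \<open>
  A normed space is given by a linear subspace \<open>X\<close> of an ambient real vector space and a
  function \<open>N\<close> whose values on \<open>X\<close> are the norm.  Functionals on \<open>X\<close> are represented by
  functions that vanish outside \<open>X\<close>, so that equal functionals are equal functions.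
\<close>

definition linear_on :: "'b::real_vector set \<Rightarrow> ('b \<Rightarrow> 'c::real_vector) \<Rightarrow> bool"
  where "linear_on X T \<longleftrightarrow>
    (\<forall>x\<in>X. \<forall>y\<in>X. T (x + y) = T x + T y) \<and> (\<forall>c. \<forall>x\<in>X. T (c *\<^sub>R x) = c *\<^sub>R T x)"

definition dual :: "'b::real_vector set \<Rightarrow> ('b \<Rightarrow> real) \<Rightarrow> ('b \<Rightarrow> real) set"
  where "dual X N =
    {\<phi>. linear_on X \<phi> \<and> (\<exists>K. \<forall>x\<in>X. \<bar>\<phi> x\<bar> \<le> K * N x) \<and> (\<forall>x. x \<notin> X \<longrightarrow> \<phi> x = 0)}"

definition dual_norm :: "'b::real_vector set \<Rightarrow> ('b \<Rightarrow> real) \<Rightarrow> ('b \<Rightarrow> real) \<Rightarrow> real"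
  where "dual_norm X N \<phi> = (SUP x\<in>{x\<in>X. N x \<le> 1}. \<bar>\<phi> x\<bar>)"

definition bidual_ball :: "'b::real_vector set \<Rightarrow> ('b \<Rightarrow> real) \<Rightarrow> (('b \<Rightarrow> real) \<Rightarrow> real) set"
  where "bidual_ball X N =
    {\<Phi> \<in> dual (dual X N) (dual_norm X N). dual_norm (dual X N) (dual_norm X N) \<Phi> \<le> 1}"

definition to_bidual :: "'b::real_vector set \<Rightarrow> ('b \<Rightarrow> real) \<Rightarrow> 'b \<Rightarrow> ('b \<Rightarrow> real) \<Rightarrow> real"
  where "to_bidual X N x = (\<lambda>\<phi>. if \<phi> \<in> dual X N then \<phi> x else 0)"

definition surj_lin_isometry :: "'b::real_vector set \<Rightarrow> ('b \<Rightarrow> real) \<Rightarrow> ('b \<Rightarrow> 'b) \<Rightarrow> bool"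
  where "surj_lin_isometry X N T \<longleftrightarrow> linear_on X T \<and> (\<forall>x\<in>X. N (T x) = N x) \<and> T ` X = X"


subsection \<open>Lipschitz-free spaces\<close>

definition lip1 :: "'a set \<Rightarrow> ('a \<Rightarrow> 'a \<Rightarrow> real) \<Rightarrow> ('a \<Rightarrow> real) set"
  where "lip1 M d = {f. \<forall>x\<in>M. \<forall>y\<in>M. \<bar>f x - f y\<bar> \<le> d x y}"

definition pre_free :: "'a set \<Rightarrow> ('a \<Rightarrow> real) set"
  where "pre_free M =
    {x. finite {m. x m \<noteq> 0} \<and> {m. x m \<noteq> 0} \<subseteq> M \<and> (\<Sum>m | x m \<noteq> 0. x m) = 0}"

definition pairing :: "('a \<Rightarrow> real) \<Rightarrow> ('a \<Rightarrow> real) \<Rightarrow> real"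
  where "pairing x f = (\<Sum>m | x m \<noteq> 0. x m * f m)"

definition pre_free_norm :: "'a set \<Rightarrow> ('a \<Rightarrow> 'a \<Rightarrow> real) \<Rightarrow> ('a \<Rightarrow> real) \<Rightarrow> real"
  where "pre_free_norm M d x = (SUP f\<in>lip1 M d. \<bar>pairing x f\<bar>)"

text \<open>
  By the definition of its norm, \<open>pre_free M\<close> embeds linearly and isometrically into the Banach
  space of bounded functions on \<open>lip1 M d\<close> with the supremum norm, an element going to its
  pairing with 1-Lipschitz functions.  The completion is realised as the closure of the image,
  i.e. the set of uniform limits on \<open>lip1 M d\<close>; as above, values outside \<open>lip1 M d\<close> are 0.
  The lemmas \<open>free_embed_linear\<close> to \<open>free_space_complete\<close> below confirm that this
  is a completion.
\<close>

definition free_embed :: "'a set \<Rightarrow> ('a \<Rightarrow> 'a \<Rightarrow> real) \<Rightarrow> ('a \<Rightarrow> real) \<Rightarrow> ('a \<Rightarrow> real) \<Rightarrow> real"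
  where "free_embed M d x = (\<lambda>f. if f \<in> lip1 M d then pairing x f else 0)"

definition free_space :: "'a set \<Rightarrow> ('a \<Rightarrow> 'a \<Rightarrow> real) \<Rightarrow> (('a \<Rightarrow> real) \<Rightarrow> real) set"
  where "free_space M d =
    {u. (\<forall>f. f \<notin> lip1 M d \<longrightarrow> u f = 0) \<and>
        (\<forall>e>0. \<exists>x\<in>pre_free M. \<forall>f\<in>lip1 M d. \<bar>u f - free_embed M d x f\<bar> \<le> e)}"

definition free_norm :: "'a set \<Rightarrow> ('a \<Rightarrow> 'a \<Rightarrow> real) \<Rightarrow> (('a \<Rightarrow> real) \<Rightarrow> real) \<Rightarrow> real"
  where "free_norm M d u = (SUP f\<in>lip1 M d. \<bar>u f\<bar>)"

definition molecule :: "'a set \<Rightarrow> ('a \<Rightarrow> 'a \<Rightarrow> real) \<Rightarrow> 'a \<Rightarrow> 'a \<Rightarrow> ('a \<Rightarrow> real) \<Rightarrow> real"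
  where "molecule M d x y =
    free_embed M d (\<lambda>m. (indicator {x} m - indicator {y} m) / d x y)"


subsection \<open>Graphs\<close>

text \<open>The edge set is a symmetric irreflexive relation; \<open>V\<close> may be infinite.\<close>

definition simple_graph :: "'a set \<Rightarrow> ('a \<times> 'a) set \<Rightarrow> bool"
  where "simple_graph V E \<longleftrightarrow> E \<subseteq> V \<times> V \<and> sym E \<and> irrefl E"

definition graph_connected :: "'a set \<Rightarrow> ('a \<times> 'a) set \<Rightarrow> bool"
  where "graph_connected V E \<longleftrightarrow> (\<forall>x\<in>V. \<forall>y\<in>V. (x, y) \<in> (E \<inter> V \<times> V)\<^sup>*)"

text \<open>
  Removal of fewer than \<open>n - 1\<close> vertices is included: otherwise the path with three vertices
  would be 3-connected, because removing any two of its vertices leaves a single one.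
  The graph without vertices counts as connected, so the complete graphs with at most
  \<open>n\<close> vertices are \<open>n\<close>-connected.
\<close>

definition n_connected :: "nat \<Rightarrow> 'a set \<Rightarrow> ('a \<times> 'a) set \<Rightarrow> bool"
  where "n_connected n V E \<longleftrightarrow>
    (\<forall>S\<subseteq>V. finite S \<and> card S \<le> n - 1 \<longrightarrow> graph_connected (V - S) E)"

text \<open>A walk of least length is a path, so the least length of a walk is that of a path.\<close>

definition graph_dist :: "('a \<times> 'a) set \<Rightarrow> 'a \<Rightarrow> 'a \<Rightarrow> real"
  where "graph_dist E x y = real (LEAST k. (x, y) \<in> E ^^ k)"


subsection \<open>Prague spaces and rigidity\<close>

definition E_ext :: "'a set \<Rightarrow> ('a \<Rightarrow> 'a \<Rightarrow> real) \<Rightarrow> ('a \<times> 'a) set"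
  where "E_ext M d = {(x, y). x \<in> M \<and> y \<in> M \<and> x \<noteq> y \<and>
    to_bidual (free_space M d) (free_norm M d) (molecule M d x y)
      extreme_point_of bidual_ball (free_space M d) (free_norm M d)}"

definition V_ext :: "'a set \<Rightarrow> ('a \<Rightarrow> 'a \<Rightarrow> real) \<Rightarrow> 'a set"
  where "V_ext M d = Field (E_ext M d)"

text \<open>The infimum includes the sequence with \<open>k = 0\<close>, which gives the value 0 for \<open>x = y\<close>.\<close>

definition prague_space :: "'a set \<Rightarrow> ('a \<Rightarrow> 'a \<Rightarrow> real) \<Rightarrow> bool"
  where "prague_space M d \<longleftrightarrow>
    Metric_space M d \<and>
    Metric_space.mtopology M d closure_of V_ext M d = M \<and>
    graph_connected (V_ext M d) (E_ext M d) \<and>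
    (\<forall>x\<in>V_ext M d. \<forall>y\<in>V_ext M d.
      d x y = Inf {\<Sum>i<k. d (p i) (p (Suc i)) | k p.
                     p 0 = x \<and> p k = y \<and> (\<forall>i<k. (p i, p (Suc i)) \<in> E_ext M d)})"

definition uniformly_concave :: "'a set \<Rightarrow> ('a \<Rightarrow> 'a \<Rightarrow> real) \<Rightarrow> bool"
  where "uniformly_concave M d \<longleftrightarrow>
    (\<forall>x\<in>M. \<forall>y\<in>M. x \<noteq> y \<longrightarrow> (\<forall>\<epsilon>>0. \<exists>\<delta>>0. \<forall>z\<in>M.
      min (d x z) (d y z) \<ge> \<epsilon> \<longrightarrow> d x z + d z y - \<delta> > d x y))"

definition dilation :: "'a set \<Rightarrow> ('a \<Rightarrow> 'a \<Rightarrow> real) \<Rightarrow> real \<Rightarrow> ('a \<Rightarrow> 'a) \<Rightarrow> bool"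
  where "dilation M d a g \<longleftrightarrow>
    a > 0 \<and> g \<in> M \<rightarrow> M \<and> (\<forall>x\<in>M. \<forall>y\<in>M. d x y = a * d (g x) (g y))"

definition lipschitz_free_rigid :: "'a set \<Rightarrow> ('a \<Rightarrow> 'a \<Rightarrow> real) \<Rightarrow> bool"
  where "lipschitz_free_rigid M d \<longleftrightarrow>
    (\<forall>T. surj_lin_isometry (free_space M d) (free_norm M d) T \<longrightarrow>
      (\<exists>\<epsilon>\<in>{1, -1::real}. \<exists>a g. dilation M d a g \<and> g ` M = M \<and>
        (\<forall>x\<in>M. \<forall>y\<in>M. x \<noteq> y \<longrightarrow> T (molecule M d x y) = \<epsilon> *\<^sub>R molecule M d (g x) (g y))))"


subsection \<open>The Lipschitz-free space is a completion\<close>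

lemma pairing_superset:
  assumes "finite A" "{m. x m \<noteq> 0} \<subseteq> A"
  shows "pairing x f = (\<Sum>m\<in>A. x m * f m)"
  unfolding pairing_def using assms by (intro sum.mono_neutral_left) auto

lemma subspace_pre_free: "subspace (pre_free M)"
proof (rule subspaceI)
  show "0 \<in> pre_free M" by (simp add: pre_free_def)
next
  fix x y :: "'a \<Rightarrow> real"
  assume x: "x \<in> pre_free M" and y: "y \<in> pre_free M"
  let ?A = "{m. x m \<noteq> 0} \<union> {m. y m \<noteq> 0}"
  have fin: "finite ?A" and sub: "?A \<subseteq> M" using x y by (auto simp: pre_free_def)
  have s: "(\<Sum>m | z m \<noteq> 0. z m) = sum z ?A" if "{m. z m \<noteq> 0} \<subseteq> ?A" for z :: "'a \<Rightarrow> real"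
    using fin that by (intro sum.mono_neutral_left) auto
  have "(\<Sum>m | (x + y) m \<noteq> 0. (x + y) m) = sum (x + y) ?A"
    by (rule s) auto
  also have "\<dots> = sum x ?A + sum y ?A"
    by (simp add: sum.distrib)
  also have "\<dots> = 0"
    using s[of x] s[of y] x y by (simp add: pre_free_def)
  finally show "x + y \<in> pre_free M"
    using fin sub finite_subset[of "{m. (x + y) m \<noteq> 0}" ?A]
    by (force simp: pre_free_def)
next
  fix c and x :: "'a \<Rightarrow> real"
  assume x: "x \<in> pre_free M"
  show "c *\<^sub>R x \<in> pre_free M"
  proof (cases "c = 0")
    case False
    then show ?thesis using x by (simp add: pre_free_def flip: sum_distrib_left)
  qed (simp add: pre_free_def)
qed

lemma free_embed_linear: "linear_on (pre_free M) (free_embed M d)"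
proof -
  have "pairing (x + y) f = pairing x f + pairing y f"
    if "x \<in> pre_free M" "y \<in> pre_free M" for x y f
  proof -
    let ?A = "{m. x m \<noteq> 0} \<union> {m. y m \<noteq> 0}"
    have fin: "finite ?A" using that by (auto simp: pre_free_def)
    show ?thesis
      using pairing_superset[OF fin, of x f] pairing_superset[OF fin, of y f]
        pairing_superset[OF fin, of "x + y" f]
      by (simp add: sum.distrib distrib_right subset_iff)
  qed
  moreover have "pairing (c *\<^sub>R x) f = c * pairing x f" if "x \<in> pre_free M" for c x f
    using that pairing_superset[of "{m. x m \<noteq> 0}" "c *\<^sub>R x" f]
    by (auto simp: pre_free_def pairing_def sum_distrib_left mult.assoc)
  ultimately show ?thesis
    by (auto simp: linear_on_def free_embed_def fun_eq_iff)
qed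

lemma free_embed_isometric: "free_norm M d (free_embed M d x) = pre_free_norm M d x"
  by (simp add: free_norm_def pre_free_norm_def free_embed_def)

lemma free_embed_in: "x \<in> pre_free M \<Longrightarrow> free_embed M d x \<in> free_space M d"
  by (force simp: free_space_def free_embed_def)

lemma subspace_free_space: "subspace (free_space M d)"
proof (rule subspaceI)
  have "free_embed M d 0 = 0" by (auto simp: free_embed_def pairing_def)
  then show "0 \<in> free_space M d"
    using free_embed_in[OF subspace_0[OF subspace_pre_free], of M d] by simp
next
  fix u v assume u: "u \<in> free_space M d" and v: "v \<in> free_space M d"
  have "\<exists>x\<in>pre_free M. \<forall>f\<in>lip1 M d. \<bar>(u + v) f - free_embed M d x f\<bar> \<le> e" if "e > 0" for e
  proof -
    have "e / 2 > 0" using that by simp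
    then obtain x y where x: "x \<in> pre_free M" "\<forall>f\<in>lip1 M d. \<bar>u f - free_embed M d x f\<bar> \<le> e/2"
      and y: "y \<in> pre_free M" "\<forall>f\<in>lip1 M d. \<bar>v f - free_embed M d y f\<bar> \<le> e/2"
      using u v unfolding free_space_def by blast
    have eq: "free_embed M d (x + y) = free_embed M d x + free_embed M d y"
      using free_embed_linear x y unfolding linear_on_def by blast
    have "\<bar>(u + v) f - free_embed M d (x + y) f\<bar> \<le> e" if "f \<in> lip1 M d" for f
      using bspec[OF x(2) that] bspec[OF y(2) that] unfolding eq plus_fun_apply by linarith
    with subspace_add[OF subspace_pre_free x(1) y(1)] show ?thesis by blast
  qed
  then show "u + v \<in> free_space M d"
    using u v by (simp add: free_space_def)
next
  fix c u assume u: "u \<in> free_space M d"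
  have "\<exists>x\<in>pre_free M. \<forall>f\<in>lip1 M d. \<bar>(c *\<^sub>R u) f - free_embed M d x f\<bar> \<le> e" if "e > 0" for e
  proof -
    have "e / (\<bar>c\<bar> + 1) > 0" using that by simp
    then obtain x where x: "x \<in> pre_free M"
        "\<forall>f\<in>lip1 M d. \<bar>u f - free_embed M d x f\<bar> \<le> e / (\<bar>c\<bar> + 1)"
      using u unfolding free_space_def by blast
    have eq: "free_embed M d (c *\<^sub>R x) = c *\<^sub>R free_embed M d x"
      using free_embed_linear x unfolding linear_on_def by blast
    have "\<bar>(c *\<^sub>R u) f - free_embed M d (c *\<^sub>R x) f\<bar> \<le> e" if f: "f \<in> lip1 M d" for f
    proof -
      have "\<bar>(c *\<^sub>R u) f - free_embed M d (c *\<^sub>R x) f\<bar> = \<bar>c\<bar> * \<bar>u f - free_embed M d x f\<bar>"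
        unfolding eq by (simp add: abs_mult flip: right_diff_distrib)
      also have "\<dots> \<le> (\<bar>c\<bar> + 1) * (e / (\<bar>c\<bar> + 1))"
        using bspec[OF x(2) f] by (intro mult_mono) auto
      also have "\<dots> = e" by (simp add: add_nonneg_eq_0_iff)
      finally show ?thesis .
    qed
    with subspace_scale[OF subspace_pre_free x(1)] show ?thesis by blast
  qed
  then show "c *\<^sub>R u \<in> free_space M d"
    using u by (simp add: free_space_def)
qed

lemma lip1_zero: "Metric_space M d \<Longrightarrow> (\<lambda>_. 0) \<in> lip1 M d"
  by (simp add: lip1_def Metric_space.nonneg)

lemma free_space_bdd:
  assumes "Metric_space M d" "u \<in> free_space M d"
  shows "bdd_above ((\<lambda>f. \<bar>u f\<bar>) ` lip1 M d)"
proof -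
  interpret Metric_space M d by fact
  obtain x where x: "x \<in> pre_free M" "\<forall>f\<in>lip1 M d. \<bar>u f - free_embed M d x f\<bar> \<le> 1"
    using assms(2) unfolding free_space_def by (auto dest: spec[of _ 1])
  have "\<exists>C. \<forall>f\<in>lip1 M d. \<bar>pairing x f\<bar> \<le> C"
  proof (cases "{m. x m \<noteq> 0} = {}")
    case False
    then obtain o' where o': "x o' \<noteq> 0" by auto
    have "\<bar>pairing x f\<bar> \<le> (\<Sum>m | x m \<noteq> 0. \<bar>x m\<bar> * d m o')" if f: "f \<in> lip1 M d" for f
    proof -
      have "pairing x f = (\<Sum>m | x m \<noteq> 0. x m * (f m - f o'))"
        using x(1) by (simp add: pairing_def pre_free_def right_diff_distrib sum_subtractf
            flip: sum_distrib_right)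
      also have "\<bar>\<dots>\<bar> \<le> (\<Sum>m | x m \<noteq> 0. \<bar>x m * (f m - f o')\<bar>)" by (rule sum_abs)
      also have "\<dots> \<le> (\<Sum>m | x m \<noteq> 0. \<bar>x m\<bar> * d m o')"
        using f o' x(1) by (intro sum_mono) (auto simp: abs_mult lip1_def pre_free_def
            intro!: mult_left_mono)
      finally show ?thesis .
    qed
    then show ?thesis by blast
  qed (auto simp: pairing_def)
  then obtain C where C: "\<forall>f\<in>lip1 M d. \<bar>pairing x f\<bar> \<le> C" by blast
  have "\<bar>u f\<bar> \<le> C + 1" if "f \<in> lip1 M d" for f
    using bspec[OF C that] bspec[OF x(2) that] that by (auto simp: free_embed_def)
  then show ?thesis by (auto simp: bdd_above_def)
qed

lemma free_norm_le_iff: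
  assumes "Metric_space M d" "u \<in> free_space M d"
  shows "free_norm M d u \<le> e \<longleftrightarrow> (\<forall>f\<in>lip1 M d. \<bar>u f\<bar> \<le> e)"
  unfolding free_norm_def using lip1_zero[OF assms(1)] free_space_bdd[OF assms]
  by (subst cSUP_le_iff) auto

lemma free_embed_dense:
  assumes "Metric_space M d" "u \<in> free_space M d" "e > 0"
  shows "\<exists>x\<in>pre_free M. free_norm M d (u - free_embed M d x) \<le> e"
proof -
  obtain x where x: "x \<in> pre_free M" "\<forall>f\<in>lip1 M d. \<bar>u f - free_embed M d x f\<bar> \<le> e"
    using assms(2,3) unfolding free_space_def by blast
  have "u - free_embed M d x \<in> free_space M d"
    by (intro subspace_diff[OF subspace_free_space] assms(2) free_embed_in x(1))
  with x show ?thesis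
    by (intro bexI[of _ x]) (auto simp: free_norm_le_iff[OF assms(1)])
qed

lemma free_space_complete:
  assumes M: "Metric_space M d" and U: "\<And>n. U n \<in> free_space M d"
    and Cauchy: "\<And>e. e > 0 \<Longrightarrow> \<exists>k. \<forall>m\<ge>k. \<forall>n\<ge>k. free_norm M d (U m - U n) \<le> e"
  shows "\<exists>u\<in>free_space M d. (\<lambda>n. free_norm M d (U n - u)) \<longlonglongrightarrow> 0"
proof -
  have unif: "\<exists>k. \<forall>m\<ge>k. \<forall>n\<ge>k. \<forall>f. \<bar>U m f - U n f\<bar> \<le> e" if e: "e > 0" for e
  proof -
    obtain k where k: "\<forall>m\<ge>k. \<forall>n\<ge>k. free_norm M d (U m - U n) \<le> e" using Cauchy[OF e] by blast
    have "\<bar>U m f - U n f\<bar> \<le> e" if "m \<ge> k" "n \<ge> k" for m n f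
    proof (cases "f \<in> lip1 M d")
      case True
      then show ?thesis
        using k that free_norm_le_iff[OF M subspace_diff[OF subspace_free_space U U]] by fastforce
    next
      case False
      then have "U m f = 0" "U n f = 0" using U[of m] U[of n] by (auto simp: free_space_def)
      then show ?thesis using \<open>e > 0\<close> by simp
    qed
    then show ?thesis by blast
  qed
  have conv: "convergent (\<lambda>n. U n f)" for f
    unfolding Cauchy_convergent_iff[symmetric]
  proof (rule metric_CauchyI)
    fix e :: real assume "e > 0"
    then obtain k where k: "\<forall>m\<ge>k. \<forall>n\<ge>k. \<forall>f. \<bar>U m f - U n f\<bar> \<le> e/2"
      using unif[of "e/2"] by auto
    have "dist (U m f) (U n f) < e" if "m \<ge> k" "n \<ge> k" for m n
    proof -
      have "\<bar>U m f - U n f\<bar> \<le> e/2" using k that by blast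
      then show ?thesis using \<open>e > 0\<close> by (simp add: dist_real_def)
    qed
    then show "\<exists>k. \<forall>m\<ge>k. \<forall>n\<ge>k. dist (U m f) (U n f) < e"
      by blast
  qed
  define u where "u f = lim (\<lambda>n. U n f)" for f
  have lim: "(\<lambda>n. U n f) \<longlonglongrightarrow> u f" for f
    using conv by (simp add: u_def convergent_LIMSEQ_iff)
  have near: "\<exists>k. \<forall>n\<ge>k. \<forall>f. \<bar>U n f - u f\<bar> \<le> e" if e: "e > 0" for e
  proof -
    obtain k where k: "\<forall>m\<ge>k. \<forall>n\<ge>k. \<forall>f. \<bar>U m f - U n f\<bar> \<le> e" using unif[OF e] by blast
    have "\<bar>U n f - u f\<bar> \<le> e" if "n \<ge> k" for n f
    proof (rule LIMSEQ_le_const2)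
      show "(\<lambda>m. \<bar>U n f - U m f\<bar>) \<longlonglongrightarrow> \<bar>U n f - u f\<bar>"
        by (intro tendsto_intros lim)
      show "\<exists>N. \<forall>m\<ge>N. \<bar>U n f - U m f\<bar> \<le> e" using k that by blast
    qed
    then show ?thesis by blast
  qed
  have u: "u \<in> free_space M d"
    unfolding free_space_def
  proof (intro CollectI conjI allI impI)
    fix f assume "f \<notin> lip1 M d"
    then have "U n f = 0" for n using U[of n] by (auto simp: free_space_def)
    then show "u f = 0" by (simp add: u_def)
  next
    fix e :: real assume "e > 0"
    then have e: "e / 2 > 0" by simp
    obtain n where n: "\<forall>f. \<bar>U n f - u f\<bar> \<le> e/2" using near[OF e] by blast
    obtain x where x: "x \<in> pre_free M" "\<forall>f\<in>lip1 M d. \<bar>U n f - free_embed M d x f\<bar> \<le> e/2"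
      using U[of n] e unfolding free_space_def by blast
    have "\<bar>u f - free_embed M d x f\<bar> \<le> e" if "f \<in> lip1 M d" for f
      using spec[OF n, of f] bspec[OF x(2) that] by linarith
    then show "\<exists>x\<in>pre_free M. \<forall>f\<in>lip1 M d. \<bar>u f - free_embed M d x f\<bar> \<le> e"
      using x(1) by blast
  qed
  moreover have "(\<lambda>n. free_norm M d (U n - u)) \<longlonglongrightarrow> 0"
  proof (rule metric_LIMSEQ_I)
    fix e :: real assume "e > 0"
    then have e: "e / 2 > 0" by simp
    obtain k where k: "\<forall>n\<ge>k. \<forall>f. \<bar>U n f - u f\<bar> \<le> e/2" using near[OF e] by blast
    have D: "U n - u \<in> free_space M d" for n by (intro subspace_diff[OF subspace_free_space] U u)
    have "free_norm M d (U n - u) \<le> e/2" if "n \<ge> k" for n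
      unfolding free_norm_le_iff[OF M D] using k that by simp
    moreover have "0 \<le> free_norm M d (U n - u)" for n
      using free_norm_le_iff[OF M D, of n "free_norm M d (U n - u)"] lip1_zero[OF M] by force
    ultimately show "\<exists>k. \<forall>n\<ge>k. dist (free_norm M d (U n - u)) 0 < e"
      using \<open>e > 0\<close> by (intro exI[of _ k]) (smt (verit) dist_real_def field_sum_of_halves)
  qed
  ultimately show ?thesis by blast
qed

end

theory Submission
  imports Defs
begin

text \<open>
  Both parts follow from one principle.  Call \<open>(x, y)\<close> a \<^emph>\<open>concave pair\<close> if a point \<open>z\<close> that stays
  away from \<open>x\<close> and \<open>y\<close> makes the detour \<open>d x z + d z y\<close> longer than \<open>d x y\<close> by a uniform amount.
  In a uniformly concave space all pairs of distinct points are concave; in a graph all edges are,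
  as every proper detour between neighbours has length at least 2.  In both cases the concave pairs
  contain a 3-connected graph \<open>E\<close> (complete graphs are 3-connected).

  \<^emph>\<open>Concave molecules are strongly isolated.\<close>  The molecule of a concave pair lies in slices of the
  ball of arbitrarily small diameter.  The slicing functional is \<open>(1 - \<tau>) F + \<tau> g\<close>, where \<open>F\<close> is a
  1-Lipschitz function with slope 1 from \<open>x\<close> to \<open>y\<close> and smaller slope on pairs with an end far from
  both, and \<open>g\<close> is constant on the ball of radius \<open>r\<close> around \<open>x\<close> and on the one around \<open>y\<close>.
  It has slope at most \<open>1 - \<tau>\<close> on every pair that does not go from near \<open>x\<close> to near \<open>y\<close>, whereas the
  molecule itself loses only \<open>2 r \<tau> / d x y\<close>; so for small \<open>r\<close> the loss is small compared with \<open>\<tau>\<close>.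
  A functional in the slice is then determined by testing it on the slicing function
  with a small multiple of an arbitrary Lipschitz function added
  (\<open>lip_functional_perturb\<close>, \<open>concave_pair_slice\<close>).  The test uses linearity and norm at most 1,
  so it applies alike to elements of the free space and of its bidual.

  This has two consequences.  A segment in the bidual ball through a concave molecule has ends
  in such slices, so it is trivial; concave pairs therefore belong to \<open>E_ext\<close>
  (\<open>concave_pair_E_ext\<close>), and the Prague property holds as soon as distances are attained by walks
  along concave pairs.  And a surjective isometry \<open>T\<close> transports the slices; every slice contains a molecule,
  so the image of a concave molecule is a limit of molecules.  In a complete space a limit of
  molecules is a molecule (\<open>limit_of_molecules\<close>), so \<open>T\<close> sends each edge of \<open>E\<close> to a multiple of a
  difference of two points, and hence maps the finitely supported elements onto themselves.

  \<^emph>\<open>A linear form of Whitney's theorem.\<close>  Let \<open>S\<close> be a linear bijection of the finitely supported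
  functions of sum zero that sends every edge of a 3-connected graph to a multiple of a difference of two
  points.  Then \<open>S\<close> is a multiple of a relabelling of the vertices.  Given a vertex \<open>v\<close>, the functional
  \<open>u \<mapsto> (S\<^sup>-\<^sup>1 u) v\<close> is given by a function \<open>q\<close> on the vertices.  Its kernel is spanned by the images
  of the edges that avoid \<open>v\<close>, which are multiples of differences of points with equal \<open>q\<close>; this leaves
  only two values for \<open>q\<close>.  If both were taken twice, the edges avoiding \<open>v\<close> would fall into
  two linearly independent families, which is impossible as removing \<open>v\<close> leaves a 2-connected graph.
  So \<open>q\<close> is constant except at one vertex, the label of \<open>v\<close>
  (\<open>vertex_coordinate_correspondence\<close>).
\<close>

section \<open>Finitely supported functions of sum zero\<close>

definition point_diff :: "'a \<Rightarrow> 'a \<Rightarrow> 'a \<Rightarrow> real"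
  where "point_diff x y = (\<lambda>m. indicator {x} m - indicator {y} m)"

lemma point_diff_apply: "point_diff x y m = (if m = x then 1 else 0) - (if m = y then 1 else 0)"
  by (simp add: point_diff_def indicator_def)

lemma point_diff_self [simp]: "point_diff x x = 0"
  by (simp add: point_diff_def fun_eq_iff)

lemma point_diff_add: "point_diff x y + point_diff y z = point_diff x z"
  by (simp add: point_diff_def fun_eq_iff)

lemma point_diff_swap: "point_diff y x = - point_diff x y"
  by (simp add: point_diff_def fun_eq_iff)

lemma pairing_point_diff: "pairing (point_diff x y) f = f x - f y"
proof -
  have "pairing (point_diff x y) f = (\<Sum>m\<in>{x, y}. point_diff x y m * f m)"
    by (rule pairing_superset) (auto simp: point_diff_apply)
  then show ?thesis by (cases "x = y") (auto simp: point_diff_apply)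
qed

lemma pre_freeD:
  assumes "u \<in> pre_free M"
  shows "finite {m. u m \<noteq> 0}" "m \<notin> M \<Longrightarrow> u m = 0" "pairing u (\<lambda>_. c) = 0"
  using assms by (auto simp: pre_free_def pairing_def simp flip: sum_distrib_right)

lemma pre_freeI:
  assumes "finite {m. u m \<noteq> 0}" "\<And>m. u m \<noteq> 0 \<Longrightarrow> m \<in> M" "pairing u (\<lambda>_. 1) = 0"
  shows "u \<in> pre_free M"
  using assms by (auto simp: pre_free_def pairing_def)

lemma point_diff_in_pre_free: "x \<in> M \<Longrightarrow> y \<in> M \<Longrightarrow> point_diff x y \<in> pre_free M"
proof (rule pre_freeI)
  show "finite {m. point_diff x y m \<noteq> 0}"
    by (rule finite_subset[of _ "{x, y}"]) (auto simp: point_diff_apply)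
qed (auto simp: pairing_point_diff point_diff_apply split: if_splits)

lemma pairing_add:
  assumes "finite {m. u m \<noteq> 0}" "finite {m. v m \<noteq> 0}"
  shows "pairing (u + v) f = pairing u f + pairing v f"
proof -
  let ?A = "{m. u m \<noteq> 0} \<union> {m. v m \<noteq> 0}"
  have fin: "finite ?A" using assms by simp
  show ?thesis
    using pairing_superset[OF fin, of u f] pairing_superset[OF fin, of v f]
      pairing_superset[OF fin, of "u + v" f]
    by (simp add: sum.distrib distrib_right subset_iff)
qed

lemma pairing_scaleR:
  assumes "finite {m. u m \<noteq> 0}"
  shows "pairing (c *\<^sub>R u) f = c * pairing u f"
  using pairing_superset[OF assms, of "c *\<^sub>R u" f]
  by (auto simp: pairing_def sum_distrib_left mult.assoc)

lemma linear_on_pairing: "linear_on (pre_free M) (\<lambda>u. pairing u f)"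
  by (simp add: linear_on_def pairing_add pairing_scaleR pre_freeD(1))

lemma linear_onD:
  assumes "linear_on X T"
  shows "x \<in> X \<Longrightarrow> y \<in> X \<Longrightarrow> T (x + y) = T x + T y" "x \<in> X \<Longrightarrow> T (c *\<^sub>R x) = c *\<^sub>R T x"
  using assms by (auto simp: linear_on_def)

lemma linear_on_0: "linear_on X T \<Longrightarrow> subspace X \<Longrightarrow> T 0 = 0"
  using linear_onD(2)[of X T 0 0] subspace_0[of X] by simp

lemma linear_on_diff:
  assumes "linear_on X T" "subspace X" "x \<in> X" "y \<in> X"
  shows "T (x - y) = T x - T y"
  using linear_onD(1)[OF assms(1), of x "(-1) *\<^sub>R y"] linear_onD(2)[OF assms(1), of y "-1"]
    subspace_scale[OF assms(2,4), of "-1"] assms by simp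

lemma linear_on_sum:
  assumes "linear_on X T" "subspace X" "finite A" "\<And>i. i \<in> A \<Longrightarrow> w i \<in> X"
  shows "T (\<Sum>i\<in>A. c i *\<^sub>R w i) = (\<Sum>i\<in>A. c i *\<^sub>R T (w i))"
  using assms(3,4)
proof (induction A rule: finite_induct)
  case empty
  then show ?case using linear_on_0[OF assms(1,2)] by simp
next
  case (insert i A)
  have "(\<Sum>i\<in>A. c i *\<^sub>R w i) \<in> X" "c i *\<^sub>R w i \<in> X"
    using insert assms(2) by (auto intro!: subspace_sum subspace_scale)
  then show ?case using insert linear_onD[OF assms(1)] by simp
qed

lemma linear_image_subspace:
  assumes "linear_on X T" "subspace X" "subspace Y"
  shows "subspace {u \<in> X. T u \<in> Y}"
  using assms linear_onD[OF assms(1)] linear_on_0[OF assms(1,2)]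
  by (auto simp: subspace_def)

lemma sum_fun_apply: "sum g A z = (\<Sum>i\<in>A. g i z)" for g :: "'i \<Rightarrow> 'a \<Rightarrow> real"
  by (induction A rule: infinite_finite_induct) auto

lemma pre_free_expand:
  assumes "u \<in> pre_free M"
  shows "u = (\<Sum>m | u m \<noteq> 0. u m *\<^sub>R point_diff m p)"
proof
  fix z
  have "(\<Sum>m | u m \<noteq> 0. u m *\<^sub>R point_diff m p) z
      = (\<Sum>m | u m \<noteq> 0. u m * indicator {m} z) - (\<Sum>m | u m \<noteq> 0. u m * indicator {p} z)"
    by (simp add: sum_fun_apply point_diff_def right_diff_distrib sum_subtractf)
  also have "(\<Sum>m | u m \<noteq> 0. u m * indicator {p} z) = 0"
    using assms by (simp add: pre_free_def flip: sum_distrib_right)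
  also have "(\<Sum>m | u m \<noteq> 0. u m * indicator {m} z) = u z"
  proof (cases "u z = 0")
    case False
    have "(\<Sum>m | u m \<noteq> 0. u m * indicator {m} z) = (\<Sum>m\<in>{z}. u m * indicator {m} z)"
      using pre_freeD(1)[OF assms] False
      by (intro sum.mono_neutral_right) (auto simp: indicator_def split: if_splits)
    then show ?thesis by simp
  qed (auto intro!: sum.neutral simp: indicator_def)
  finally show "u z = (\<Sum>m | u m \<noteq> 0. u m *\<^sub>R point_diff m p) z" by (simp only: diff_zero)
qed

lemma linear_on_pre_free_expand:
  assumes "linear_on (pre_free M) T" "u \<in> pre_free M" "p \<in> M"
  shows "T u = (\<Sum>m | u m \<noteq> 0. u m *\<^sub>R T (point_diff m p))"
proof -
  have "T (\<Sum>m | u m \<noteq> 0. u m *\<^sub>R point_diff m p) = (\<Sum>m | u m \<noteq> 0. u m *\<^sub>R T (point_diff m p))"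
    using pre_freeD[OF assms(2)] assms(3)
    by (intro linear_on_sum[OF assms(1) subspace_pre_free]) (auto intro!: point_diff_in_pre_free)
  then show ?thesis using pre_free_expand[OF assms(2), of p] by simp
qed

text \<open>
  Functionals on sum-zero functions are functions on the points, up to a constant that the choice
  of the base point \<open>p\<close> fixes.
\<close>

lemma linear_functional_pre_free:
  assumes "linear_on (pre_free M) \<psi>" "u \<in> pre_free M" "p \<in> M"
  shows "\<psi> u = pairing u (\<lambda>m. \<psi> (point_diff m p))"
  using linear_on_pre_free_expand[OF assms] by (simp add: pairing_def)

definition edge_diffs :: "'a set \<Rightarrow> ('a \<times> 'a) set \<Rightarrow> ('a \<Rightarrow> real) set"
  where "edge_diffs U E = {point_diff a b |a b. (a, b) \<in> E \<inter> U \<times> U}"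

lemma edge_diffs_subset_pre_free: "edge_diffs U E \<subseteq> pre_free U"
  by (auto simp: edge_diffs_def intro: point_diff_in_pre_free)

lemma point_diff_in_span:
  assumes "graph_connected U E" "x \<in> U" "y \<in> U"
  shows "point_diff x y \<in> span (edge_diffs U E)"
proof -
  have "(x, y) \<in> (E \<inter> U \<times> U)\<^sup>*" using assms by (auto simp: graph_connected_def)
  then show ?thesis
  proof (induction rule: rtrancl_induct)
    case base
    show ?case unfolding point_diff_self by (rule span_zero)
  next
    case (step y z)
    have "point_diff y z \<in> span (edge_diffs U E)"
      using step(2) by (auto simp: edge_diffs_def intro: span_base)
    from span_add[OF step(3) this] show ?case by (simp only: point_diff_add)
  qed
qed

lemma pre_free_eq_span:
  assumes "graph_connected U E"
  shows "pre_free U = span (edge_diffs U E)"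
proof
  show "span (edge_diffs U E) \<subseteq> pre_free U"
    by (intro span_minimal edge_diffs_subset_pre_free subspace_pre_free)
  show "pre_free U \<subseteq> span (edge_diffs U E)"
  proof
    fix u assume u: "u \<in> pre_free U"
    show "u \<in> span (edge_diffs U E)"
    proof (cases "U = {}")
      case True
      then have "u = 0" using pre_freeD(2)[OF u] by (auto simp: fun_eq_iff)
      then show ?thesis by (simp add: span_zero)
    next
      case False
      then obtain p where p: "p \<in> U" by blast
      have "(\<Sum>m | u m \<noteq> 0. u m *\<^sub>R point_diff m p) \<in> span (edge_diffs U E)"
        using pre_freeD(2)[OF u] p
        by (intro span_sum span_scale point_diff_in_span[OF assms]) auto
      then show ?thesis using pre_free_expand[OF u, of p] by simp
    qed
  qed
qed

section \<open>Linear maps sending edges to multiples of differences\<close>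

lemma add_nonzeroD: "a + b \<noteq> (0 :: real) \<Longrightarrow> a \<noteq> 0 \<or> b \<noteq> 0"
  by auto

text \<open>
  This is the statement that the cycle matroid of a 2-connected graph is connected, with ``lie on a
  common cycle'' replaced by linear algebra.  If both parts occurred, some vertex \<open>w\<close> would have an edge to
  \<open>x\<close> in \<open>P1\<close> and one to \<open>y\<close> in \<open>P2\<close>.  A path from \<open>x\<close> to \<open>y\<close> that avoids \<open>w\<close> gives a second
  decomposition of \<open>point_diff x y\<close> into \<open>P1\<close> and \<open>P2\<close>, with terms that vanish at \<open>w\<close>, against the
  independence of \<open>P1\<close> and \<open>P2\<close>.
\<close>

lemma two_connected_edges_not_split:
  assumes E: "sym E"
    and conn: "graph_connected U E"
    and conn1: "\<And>w. w \<in> U \<Longrightarrow> graph_connected (U - {w}) E"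
    and loop: "\<And>a. (a, a) \<notin> E"
    and P1: "subspace P1" and P2: "subspace P2" and disj: "P1 \<inter> P2 \<subseteq> {0}"
    and cover: "edge_diffs U E \<subseteq> P1 \<union> P2"
  shows "edge_diffs U E \<subseteq> P1 \<or> edge_diffs U E \<subseteq> P2"
proof (rule ccontr)
  let ?F = "E \<inter> U \<times> U"
  assume "\<not> ?thesis"
  then obtain a b c e where ab: "(a, b) \<in> ?F" "point_diff a b \<notin> P2"
    and ce: "(c, e) \<in> ?F" "point_diff c e \<notin> P1"
    unfolding edge_diffs_def by blast
  have cover': "point_diff x y \<in> P1 \<or> point_diff x y \<in> P2" if "(x, y) \<in> ?F" for x y
    using cover that unfolding edge_diffs_def by blast
  have swap: "point_diff y x \<in> P \<longleftrightarrow> point_diff x y \<in> P" if "subspace P" for P x y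
    using subspace_neg[OF that] point_diff_swap by metis
  have F_sym: "(y, x) \<in> ?F" if "(x, y) \<in> ?F" for x y
    using that E by (auto dest: symD)
  have "\<exists>w x y. (w, x) \<in> ?F \<and> (w, y) \<in> ?F \<and> point_diff w x \<in> P1 \<and> point_diff w y \<in> P2"
  proof (rule ccontr)
    assume no: "\<not> ?thesis"
    have "(a, c) \<in> ?F\<^sup>*"
      using conn ab ce by (auto simp: graph_connected_def)
    then have "\<exists>y. (c, y) \<in> ?F \<and> point_diff c y \<in> P1"
    proof (induction rule: rtrancl_induct)
      case base
      then show ?case using ab cover' by blast
    next
      case (step u v)
      then have "point_diff u v \<in> P1" using cover' no by blast
      then show ?case using step(2) F_sym swap[OF P1] by blast
    qed
    then show False using no ce cover' by blast
  qed
  then obtain w x y where wx: "(w, x) \<in> ?F" "point_diff w x \<in> P1"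
    and wy: "(w, y) \<in> ?F" "point_diff w y \<in> P2" by blast
  \<comment> \<open>sums of elements of \<open>P1\<close> and \<open>P2\<close> that do not see \<open>w\<close>; paths avoiding \<open>w\<close> stay in this space\<close>
  define Q where "Q = {p1 + p2 |p1 p2. p1 \<in> {p \<in> P1. p w = 0} \<and> p2 \<in> {p \<in> P2. p w = 0}}"
  have sub0: "subspace {p \<in> P. p w = 0}" if "subspace P" for P :: "('a \<Rightarrow> real) set"
    using that by (auto simp: subspace_def)
  have "subspace Q"
    unfolding Q_def by (rule subspace_sums[OF sub0[OF P1] sub0[OF P2]])
  moreover have "edge_diffs (U - {w}) E \<subseteq> Q"
  proof
    fix p assume "p \<in> edge_diffs (U - {w}) E"
    then obtain s t where st: "p = point_diff s t" "(s, t) \<in> ?F" "s \<noteq> w" "t \<noteq> w"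
      unfolding edge_diffs_def by blast
    then have "p w = 0" by (simp add: point_diff_apply)
    moreover have "p = p + 0" "p = 0 + p" by simp_all
    moreover have "(0 :: 'a \<Rightarrow> real) w = 0" by simp
    ultimately show "p \<in> Q"
      using cover'[OF st(2)] st(1) subspace_0[OF P1] subspace_0[OF P2] unfolding Q_def by blast
  qed
  moreover have "point_diff x y \<in> span (edge_diffs (U - {w}) E)"
    using wx wy loop by (intro point_diff_in_span conn1) auto
  ultimately have "point_diff x y \<in> Q"
    using span_minimal by blast
  then obtain p1 p2 where p: "point_diff x y = p1 + p2" "p1 \<in> P1" "p2 \<in> P2" "p1 w = 0"
    unfolding Q_def by blast
  have "point_diff x w - p1 = p2 - point_diff w y"
    using p(1) point_diff_add[of x w y] by (simp add: algebra_simps)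
  moreover have "point_diff x w - p1 \<in> P1"
    using wx p swap[OF P1] by (intro subspace_diff[OF P1]) auto
  moreover have "p2 - point_diff w y \<in> P2"
    using wy p by (intro subspace_diff[OF P2]) auto
  ultimately have "point_diff x w = p1"
    using disj by auto
  moreover have "x \<noteq> w" using wx loop by auto
  ultimately show False using p(4) by (auto simp: point_diff_apply)
qed

text \<open>
  The coordinate at \<open>v\<close> of the preimage is, up to a factor, the coordinate at a vertex \<open>w\<close> of the
  image: the functional reading off the former is given by a function \<open>q\<close> with just two values,
  and one of them is taken only at \<open>w\<close> because removing \<open>v\<close> leaves a 2-connected graph.
\<close>

lemma vertex_coordinate_correspondence:
  assumes E: "simple_graph V E" and conn: "n_connected 3 V E"
    and S: "linear_on (pre_free V) S" and bij: "bij_betw S (pre_free V) (pre_free V)"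
    and edges: "\<And>x y. (x, y) \<in> E \<Longrightarrow> \<exists>a\<in>V. \<exists>b\<in>V. \<exists>c. S (point_diff x y) = c *\<^sub>R point_diff a b"
    and v: "v \<in> V" and v': "v' \<in> V" "v' \<noteq> v"
  shows "\<exists>w\<in>V. \<exists>c. c \<noteq> 0 \<and> (\<forall>u\<in>pre_free V. u v = c * S u w)"
proof -
  let ?X = "pre_free V" and ?U = "V - {v}"
  define R where "R = inv_into ?X S"
  have RS: "R (S u) = u" if "u \<in> ?X" for u
    using bij that by (simp add: R_def bij_betw_inv_into_left)
  have SR: "S (R u) = u" if "u \<in> ?X" for u
    using bij that by (simp add: R_def bij_betw_inv_into_right)
  have S_in: "S u \<in> ?X" and R_in: "R u \<in> ?X" if "u \<in> ?X" for u
    using that bij_betwE[OF bij] bij_betwE[OF bij_betw_inv_into[OF bij]] by (auto simp: R_def)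
  note sX = subspace_pre_free[of V]
  have R: "linear_on ?X R"
    unfolding linear_on_def
  proof (intro conjI ballI allI)
    fix x y assume xy: "x \<in> ?X" "y \<in> ?X"
    have "S (R x + R y) = x + y"
      using xy linear_onD(1)[OF S R_in R_in] by (simp add: SR)
    then show "R (x + y) = R x + R y"
      using RS[OF subspace_add[OF sX R_in[OF xy(1)] R_in[OF xy(2)]]] by simp
  next
    fix c x assume x: "x \<in> ?X"
    have "S (c *\<^sub>R R x) = c *\<^sub>R x"
      using x linear_onD(2)[OF S R_in] by (simp add: SR)
    then show "R (c *\<^sub>R x) = c *\<^sub>R R x"
      using RS[OF subspace_scale[OF sX R_in[OF x]]] by metis
  qed
  have E': "sym E" "(a, a) \<notin> E" for a
    using E by (auto simp: simple_graph_def irrefl_def)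
  have conn_U: "graph_connected ?U E"
    using conn v unfolding n_connected_def by (auto dest!: spec[of _ "{v}"])
  have conn_Uw: "graph_connected (?U - {w}) E" if "w \<in> ?U" for w
  proof -
    have "card {v, w} \<le> 3 - 1" by (simp add: card_insert_if)
    then have "graph_connected (V - {v, w}) E"
      using conn v that unfolding n_connected_def by (auto dest!: spec[of _ "{v, w}"])
    moreover have "V - {v, w} = ?U - {w}" by auto
    ultimately show ?thesis by simp
  qed
  \<comment> \<open>the function on \<open>V\<close> representing the functional that reads off the coordinate at \<open>v\<close> of the preimage\<close>
  define q where "q m = R (point_diff m v') v" for m
  have psi: "R u v = pairing u q" if "u \<in> ?X" for u
  proof -
    have "linear_on ?X (\<lambda>u. R u v)"
      using R by (simp add: linear_on_def)
    from linear_functional_pre_free[OF this that v'(1)] show ?thesis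
      by (simp add: q_def[abs_def])
  qed
  have ker: "R u \<in> span (edge_diffs ?U E)" if u: "u \<in> ?X" "pairing u q = 0" for u
  proof -
    have "R u \<in> pre_free ?U"
      using R_in[OF u(1)] psi[OF u(1)] u(2) by (auto simp: pre_free_def)
    then show ?thesis by (simp add: pre_free_eq_span[OF conn_U])
  qed
  have U_V: "pre_free ?U \<subseteq> ?X" by (auto simp: pre_free_def)
  have image_edge: "\<exists>a\<in>V. \<exists>b\<in>V. \<exists>c. q a = q b \<and> S p = c *\<^sub>R point_diff a b"
    if p: "p \<in> edge_diffs ?U E" for p
  proof -
    have pX: "p \<in> ?X" using p edge_diffs_subset_pre_free U_V by blast
    obtain x y where xy: "p = point_diff x y" "(x, y) \<in> E" "x \<noteq> v" "y \<noteq> v"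
      using p unfolding edge_diffs_def by blast
    then obtain a b c where ab: "a \<in> V" "b \<in> V" "S p = c *\<^sub>R point_diff a b"
      using edges by blast
    have "c * (q a - q b) = pairing (S p) q"
      using ab pre_freeD(1)[OF point_diff_in_pre_free[OF ab(1,2)]]
      by (simp add: pairing_scaleR pairing_point_diff)
    also have "\<dots> = p v"
      using psi[OF S_in[OF pX]] RS[OF pX] by simp
    also have "\<dots> = 0" using xy by (simp add: point_diff_apply)
    finally have "c = 0 \<or> q a = q b" by simp
    then show ?thesis
    proof
      assume "c = 0"
      then have "S p = 0 *\<^sub>R point_diff v v" using ab by simp
      then show ?thesis using v by blast
    qed (use ab in blast)
  qed
  \<comment> \<open>any function that factors through \<open>q\<close> also annihilates the kernel of \<open>q\<close>, since it
    annihilates the images of the edges avoiding \<open>v\<close>, which span that kernel\<close>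
  have level: "pairing u (\<lambda>m. h (q m)) = 0" if u: "u \<in> ?X" "pairing u q = 0" for u h
  proof -
    let ?Y = "{p \<in> ?X. S p \<in> {w \<in> ?X. pairing w (\<lambda>m. h (q m)) \<in> {0}}}"
    have "subspace {w \<in> ?X. pairing w (\<lambda>m. h (q m)) \<in> {0}}"
      by (intro linear_image_subspace linear_on_pairing sX subspace_single_0)
    then have "subspace ?Y"
      by (rule linear_image_subspace[OF S sX])
    moreover have "edge_diffs ?U E \<subseteq> ?Y"
    proof
      fix p assume p: "p \<in> edge_diffs ?U E"
      then have pX: "p \<in> ?X" using edge_diffs_subset_pre_free U_V by blast
      obtain a b c where ab: "a \<in> V" "b \<in> V" "q a = q b" "S p = c *\<^sub>R point_diff a b"
        using image_edge[OF p] by blast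
      then have "pairing (S p) (\<lambda>m. h (q m)) = 0"
        using pre_freeD(1)[OF point_diff_in_pre_free[OF ab(1,2)]]
        by (simp add: pairing_scaleR pairing_point_diff)
      then show "p \<in> ?Y" using pX S_in by simp
    qed
    ultimately have "R u \<in> ?Y"
      using ker[OF u] span_minimal by blast
    then show ?thesis using SR[OF u(1)] by simp
  qed
  have "\<exists>x1\<in>V. \<exists>x2\<in>V. q x1 \<noteq> q x2"
  proof (rule ccontr)
    assume "\<not> ?thesis"
    then have "q m = q v" if "m \<in> V" for m using v that by blast
    moreover have p: "point_diff v v' \<in> ?X"
      using v v' by (intro point_diff_in_pre_free)
    moreover note s = S_in[OF p]
    ultimately have "pairing (S (point_diff v v')) q = pairing (S (point_diff v v')) (\<lambda>_. q v)"
      using pre_freeD(2)[OF s] unfolding pairing_def by (intro sum.cong) auto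
    also have "\<dots> = 0" by (rule pre_freeD(3)[OF s])
    finally have "point_diff v v' v = 0"
      using psi[OF s] RS[OF p] by simp
    then show False using v' by (simp add: point_diff_apply)
  qed
  then obtain x1 x2 where x12: "x1 \<in> V" "x2 \<in> V" "q x1 \<noteq> q x2" by blast
  have two: "q y = q x1 \<or> q y = q x2" if y: "y \<in> V" for y
  proof (rule ccontr)
    assume no: "\<not> ?thesis"
    \<comment> \<open>a combination in the kernel of \<open>q\<close> that the indicator of the level set of \<open>x1\<close> detects\<close>
    let ?u = "(q x2 - q y) *\<^sub>R point_diff x1 y - (q x1 - q y) *\<^sub>R point_diff x2 y"
    have uX: "?u \<in> ?X"
      using x12 y by (intro subspace_diff[OF sX] subspace_scale[OF sX] point_diff_in_pre_free)
    have val: "pairing ?u f = (q x2 - q y) * (f x1 - f y) - (q x1 - q y) * (f x2 - f y)" for f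
    proof -
      have X: "point_diff x1 y \<in> ?X" "point_diff x2 y \<in> ?X"
        using x12 y by (auto intro: point_diff_in_pre_free)
      note lin = linear_on_pairing[of V f]
      show ?thesis
        unfolding linear_on_diff[OF lin sX subspace_scale[OF sX X(1)] subspace_scale[OF sX X(2)]]
          linear_onD(2)[OF lin X(1)] linear_onD(2)[OF lin X(2)] pairing_point_diff
        by simp
    qed
    have "pairing ?u q = 0" by (simp add: val)
    from level[OF uX this, of "\<lambda>t. if t = q x1 then 1 else 0"]
    have "q x2 - q y = 0" using no x12 by (simp add: val)
    then show False using no by simp
  qed
  \<comment> \<open>preimages of the functions that live on one level set of \<open>q\<close>\<close>
  define supp where "supp t = {p \<in> ?X. S p \<in> {w \<in> ?X. \<forall>m. w m \<noteq> 0 \<longrightarrow> q m = t}}" for t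
  have sub_supp: "subspace (supp t)" for t
  proof -
    have "subspace {w \<in> ?X. \<forall>m. w m \<noteq> 0 \<longrightarrow> q m = t}"
      by (rule subspaceI)
        (auto intro: subspace_0[OF sX] subspace_add[OF sX] subspace_scale[OF sX] dest: add_nonzeroD)
    then show ?thesis unfolding supp_def by (intro linear_image_subspace S sX)
  qed
  have disj: "supp (q x1) \<inter> supp (q x2) \<subseteq> {0}"
  proof
    fix p assume p: "p \<in> supp (q x1) \<inter> supp (q x2)"
    then have "S p = 0" using x12 by (auto simp: supp_def fun_eq_iff)
    then have "S p = S 0" using linear_on_0[OF S sX] by simp
    then show "p \<in> {0}" using RS[of p] RS[of 0] subspace_0[OF sX] p by (auto simp: supp_def)
  qed
  have cover: "edge_diffs ?U E \<subseteq> supp (q x1) \<union> supp (q x2)"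
  proof
    fix p assume p: "p \<in> edge_diffs ?U E"
    then have pX: "p \<in> ?X" using edge_diffs_subset_pre_free U_V by blast
    obtain a b c where ab: "a \<in> V" "b \<in> V" "q a = q b" "S p = c *\<^sub>R point_diff a b"
      using image_edge[OF p] by blast
    then have "\<forall>m. S p m \<noteq> 0 \<longrightarrow> q m = q a"
      by (auto simp: point_diff_apply)
    then have "p \<in> supp (q a)" using pX S_in by (simp add: supp_def)
    then show "p \<in> supp (q x1) \<union> supp (q x2)" using two[OF ab(1)] by auto
  qed
  \<comment> \<open>a level set with two points \<open>x\<close>, \<open>y\<close> carries the image of some edge, because \<open>point_diff x y\<close>
    is in the kernel of \<open>q\<close>, hence in the span of images of edges\<close>
  have single: "\<not> edge_diffs ?U E \<subseteq> supp t"
    if xy: "x \<in> V" "y \<in> V" "x \<noteq> y" "q x = q y" "q x \<noteq> t" for x y t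
  proof
    assume all: "edge_diffs ?U E \<subseteq> supp t"
    have X: "point_diff x y \<in> ?X" using xy by (intro point_diff_in_pre_free)
    have "R (point_diff x y) \<in> supp t"
      using ker[OF X] span_minimal[OF all sub_supp] xy by (auto simp: pairing_point_diff)
    then have "\<forall>m. point_diff x y m \<noteq> 0 \<longrightarrow> q m = t"
      using SR[OF X] by (simp add: supp_def)
    then show False using xy by (auto simp: point_diff_apply dest: spec[of _ x])
  qed
  have "\<exists>w\<in>V. \<exists>t. q w \<noteq> t \<and> (\<forall>y\<in>V. y \<noteq> w \<longrightarrow> q y = t)"
  proof (cases "\<exists>y\<in>V. y \<noteq> x1 \<and> q y = q x1")
    case False
    then show ?thesis using x12 two by blast
  next
    case True
    then have "\<not> edge_diffs ?U E \<subseteq> supp (q x2)" using single[OF x12(1)] x12 by metis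
    then have "edge_diffs ?U E \<subseteq> supp (q x1)"
      using two_connected_edges_not_split[OF E'(1) conn_U conn_Uw E'(2) sub_supp sub_supp disj cover]
      by blast
    then have "\<not> (\<exists>y\<in>V. y \<noteq> x2 \<and> q y = q x2)" using single[OF x12(2)] x12 by metis
    then show ?thesis using x12 two by metis
  qed
  then obtain w t where w: "w \<in> V" "q w \<noteq> t" "\<And>y. y \<in> V \<Longrightarrow> y \<noteq> w \<Longrightarrow> q y = t" by blast
  have "u v = (q w - t) * S u w" if u: "u \<in> ?X" for u
  proof -
    have Su: "S u \<in> ?X" using S_in u .
    have "u v = pairing (S u) q" using psi[OF Su] RS[OF u] by simp
    also have "\<dots> = (\<Sum>m\<in>{m. S u m \<noteq> 0} \<union> {w}. S u m * q m)"
      using pre_freeD(1)[OF Su] by (intro pairing_superset) auto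
    also have "\<dots> = (\<Sum>m\<in>{m. S u m \<noteq> 0} \<union> {w}. S u m * t + (if m = w then S u m * (q w - t) else 0))"
      using w(3) pre_freeD(2)[OF Su] by (intro sum.cong refl) (force simp: algebra_simps)
    also have "\<dots> = (\<Sum>m\<in>{m. S u m \<noteq> 0} \<union> {w}. S u m * t) + S u w * (q w - t)"
      using pre_freeD(1)[OF Su] by (simp add: sum.distrib)
    also have "(\<Sum>m\<in>{m. S u m \<noteq> 0} \<union> {w}. S u m * t) = pairing (S u) (\<lambda>_. t)"
      using pre_freeD(1)[OF Su] by (intro pairing_superset[symmetric]) auto
    also have "\<dots> = 0" by (rule pre_freeD(3)[OF Su])
    finally show ?thesis by simp
  qed
  then show ?thesis using w(1,2) by (intro bexI[of _ w] exI[of _ "q w - t"]) auto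
qed

text \<open>
  The correspondence of coordinates makes \<open>S (point_diff x y)\<close> vanish off the labels of \<open>x\<close> and \<open>y\<close>, and
  the sum being zero forces equal factors at both.  On two vertices both coordinates agree up to sign, so
  either vertex would serve as the label of either; a third vertex separates the labels.
\<close>

lemma vertex_relabelling:
  assumes E: "simple_graph V E" and conn: "n_connected 3 V E"
    and S: "linear_on (pre_free V) S" and bij: "bij_betw S (pre_free V) (pre_free V)"
    and edges: "\<And>x y. (x, y) \<in> E \<Longrightarrow> \<exists>a\<in>V. \<exists>b\<in>V. \<exists>c. S (point_diff x y) = c *\<^sub>R point_diff a b"
    and three: "\<And>a b. \<exists>z\<in>V. z \<noteq> a \<and> z \<noteq> b"
  shows "\<exists>g \<kappa>. \<kappa> \<noteq> 0 \<and> bij_betw g V V \<and>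
    (\<forall>x\<in>V. \<forall>y\<in>V. S (point_diff x y) = \<kappa> *\<^sub>R point_diff (g x) (g y))"
proof -
  let ?X = "pre_free V"
  have "\<forall>v\<in>V. \<exists>w c. w \<in> V \<and> c \<noteq> 0 \<and> (\<forall>u\<in>?X. u v = c * S u w)"
  proof
    fix v assume "v \<in> V"
    moreover obtain v' where "v' \<in> V" "v' \<noteq> v" using three by blast
    ultimately show "\<exists>w c. w \<in> V \<and> c \<noteq> 0 \<and> (\<forall>u\<in>?X. u v = c * S u w)"
      using vertex_coordinate_correspondence[OF E conn S bij edges] by blast
  qed
  then obtain g c where gV: "\<And>v. v \<in> V \<Longrightarrow> g v \<in> V" and c: "\<And>v. v \<in> V \<Longrightarrow> c v \<noteq> (0::real)"
    and g: "\<And>v u. v \<in> V \<Longrightarrow> u \<in> ?X \<Longrightarrow> u v = c v * S u (g v)"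
    by metis
  have S_in: "S u \<in> ?X" if "u \<in> ?X" for u using bij_betwE[OF bij] that by blast
  have inj: "inj_on g V"
  proof (rule inj_onI, rule ccontr)
    fix v w assume vw: "v \<in> V" "w \<in> V" "g v = g w" "v \<noteq> w"
    obtain z where z: "z \<in> V" "z \<noteq> v" "z \<noteq> w" using three by blast
    have X: "point_diff v z \<in> ?X" using vw z by (intro point_diff_in_pre_free)
    show False
      using g[OF vw(1) X] g[OF vw(2) X] c[OF vw(2)] vw z by (simp add: point_diff_apply)
  qed
  have surj: "w \<in> g ` V" if w: "w \<in> V" for w
  proof (rule ccontr)
    assume nw: "w \<notin> g ` V"
    let ?Y = "{u \<in> ?X. S u \<in> {p. p w = 0}}"
    have "subspace {p :: 'a \<Rightarrow> real. p w = 0}" by (auto simp: subspace_def)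
    then have "subspace ?Y" by (intro linear_image_subspace S subspace_pre_free)
    moreover have "edge_diffs V E \<subseteq> ?Y"
    proof
      fix p assume p: "p \<in> edge_diffs V E"
      then obtain x y where xy: "p = point_diff x y" "(x, y) \<in> E" "x \<in> V" "y \<in> V"
        unfolding edge_diffs_def by blast
      then have ne: "x \<noteq> y" using E by (auto simp: simple_graph_def irrefl_def)
      have X: "p \<in> ?X" using p edge_diffs_subset_pre_free by blast
      obtain a b k where ab: "S p = k *\<^sub>R point_diff a b" using edges[OF xy(2)] xy(1) by blast
      have "S p (g x) \<noteq> 0" "S p (g y) \<noteq> 0"
        using g[OF xy(3) X] g[OF xy(4) X] ne xy(1) by (auto simp: point_diff_apply)
      then have "{g x, g y} \<subseteq> {a, b}"
        unfolding ab by (auto simp: point_diff_apply split: if_splits)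
      moreover have "g x \<noteq> g y" using inj xy ne by (auto simp: inj_on_def)
      ultimately have "{a, b} = {g x, g y}" by auto
      then have "w \<noteq> a" "w \<noteq> b" using nw xy by blast+
      then have "S p w = 0" unfolding ab by (simp add: point_diff_apply)
      then show "p \<in> ?Y" using X by simp
    qed
    moreover have "graph_connected V E"
      using conn[unfolded n_connected_def, rule_format, of "{}"] by simp
    ultimately have all: "?X \<subseteq> ?Y"
      using span_minimal[of "edge_diffs V E" ?Y] pre_free_eq_span[of V E] by simp
    obtain z where z: "z \<in> V" "z \<noteq> w" using three by blast
    have "point_diff w z \<in> S ` ?X"
      using bij point_diff_in_pre_free[OF w z(1)] by (simp add: bij_betw_def)
    then have "point_diff w z w = 0" using all by auto
    then show False using z by (simp add: point_diff_apply)
  qed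
  have key: "S (point_diff x y) = (1 / c x) *\<^sub>R point_diff (g x) (g y) \<and> c x = c y"
    if xy: "x \<in> V" "y \<in> V" "x \<noteq> y" for x y
  proof -
    let ?p = "point_diff x y"
    have X: "?p \<in> ?X" using xy by (intro point_diff_in_pre_free)
    have gne: "g x \<noteq> g y" using inj xy by (auto simp: inj_on_def)
    have off: "S ?p z = 0" if z: "z \<noteq> g x" "z \<noteq> g y" for z
    proof (cases "z \<in> V")
      case True
      then obtain z' where z': "z' \<in> V" "z = g z'" using surj by blast
      then have "z' \<noteq> x" "z' \<noteq> y" using z by auto
      then show ?thesis using g[OF z'(1) X] c[OF z'(1)] z' by (simp add: point_diff_apply)
    qed (rule pre_freeD(2)[OF S_in[OF X]])
    have gx: "S ?p (g x) = 1 / c x"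
      using g[OF xy(1) X] c[OF xy(1)] xy(3) by (simp add: point_diff_apply field_simps)
    have gy: "S ?p (g y) = - 1 / c y"
      using g[OF xy(2) X] c[OF xy(2)] xy(3) by (simp add: point_diff_apply field_simps)
    have "0 = pairing (S ?p) (\<lambda>_. 1)" using pre_freeD(3)[OF S_in[OF X]] by simp
    also have "\<dots> = (\<Sum>m\<in>{g x, g y}. S ?p m * 1)"
      using off by (intro pairing_superset) auto
    finally have cc: "c x = c y"
      using gne gx gy c[OF xy(1)] c[OF xy(2)] by (simp add: field_simps)
    have "S ?p = (1 / c x) *\<^sub>R point_diff (g x) (g y)"
    proof
      fix z
      show "S ?p z = ((1 / c x) *\<^sub>R point_diff (g x) (g y)) z"
        using off[of z] gx gy gne cc by (auto simp: point_diff_apply)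
    qed
    with cc show ?thesis by simp
  qed
  obtain p where p: "p \<in> V" using three by blast
  have cp: "c x = c p" if "x \<in> V" for x using key[of x p] p that by (cases "x = p") auto
  have "S (point_diff x y) = (1 / c p) *\<^sub>R point_diff (g x) (g y)" if xy: "x \<in> V" "y \<in> V" for x y
  proof (cases "x = y")
    case True
    then show ?thesis using linear_on_0[OF S subspace_pre_free] by simp
  next
    case False
    then show ?thesis using key[of x y] cp[of x] xy by simp
  qed
  moreover have "bij_betw g V V"
    using inj surj gV by (auto simp: bij_betw_def)
  moreover have "1 / c p \<noteq> 0" using c[OF p] by simp
  ultimately show ?thesis by blast
qed

section \<open>Slices at molecules of concave pairs\<close>

text \<open>
  The common ground of the unit balls of the free space and of its bidual: what either sees of
  1-Lipschitz functions.  Linearity is asked only for combinations that are again 1-Lipschitz, because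
  elements of the free space vanish outside \<open>lip1 M d\<close>.
\<close>

definition lip_functional :: "'a set \<Rightarrow> ('a \<Rightarrow> 'a \<Rightarrow> real) \<Rightarrow> (('a \<Rightarrow> real) \<Rightarrow> real) \<Rightarrow> bool"
  where "lip_functional M d \<Phi> \<longleftrightarrow>
    (\<forall>f\<in>lip1 M d. \<bar>\<Phi> f\<bar> \<le> 1) \<and>
    (\<forall>f\<in>lip1 M d. \<forall>g\<in>lip1 M d. \<forall>a b.
      (\<lambda>z. a * f z + b * g z) \<in> lip1 M d \<longrightarrow> \<Phi> (\<lambda>z. a * f z + b * g z) = a * \<Phi> f + b * \<Phi> g)"

definition concave_pair :: "'a set \<Rightarrow> ('a \<Rightarrow> 'a \<Rightarrow> real) \<Rightarrow> 'a \<Rightarrow> 'a \<Rightarrow> bool"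
  where "concave_pair M d x y \<longleftrightarrow> x \<in> M \<and> y \<in> M \<and> x \<noteq> y \<and>
    (\<forall>\<epsilon>>0. \<exists>\<delta>>0. \<forall>z\<in>M. min (d x z) (d y z) \<ge> \<epsilon> \<longrightarrow> d x z + d z y \<ge> d x y + \<delta>)"

lemma lip1I:
  assumes "\<And>u v. u \<in> M \<Longrightarrow> v \<in> M \<Longrightarrow> f u - f v \<le> d u v" "\<And>u v. d u v = d v u"
  shows "f \<in> lip1 M d"
  unfolding lip1_def
proof (intro CollectI ballI)
  fix u v assume "u \<in> M" "v \<in> M"
  with assms(1)[of u v] assms(1)[of v u] assms(2)[of u v] show "\<bar>f u - f v\<bar> \<le> d u v" by linarith
qed

lemma lip1D: "f \<in> lip1 M d \<Longrightarrow> u \<in> M \<Longrightarrow> v \<in> M \<Longrightarrow> f u - f v \<le> d u v"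
  by (force simp: lip1_def)

context Metric_space
begin

lemma lip1_dist: assumes "p \<in> M" shows "(\<lambda>z. d z p) \<in> lip1 M d"
  by (rule lip1I[OF _ commute]) (use triangle assms in \<open>force simp: algebra_simps\<close>)

definition peak_fun :: "'a \<Rightarrow> 'a \<Rightarrow> 'a \<Rightarrow> real"
  where "peak_fun x y z = d x y / 2 * (d z y - d z x) / (d z y + d z x)"

text \<open>
  With \<open>a = d u x\<close>, \<open>b = d u y\<close> and \<open>a'\<close>, \<open>b'\<close> for \<open>v\<close>, the difference of the values is
  \<open>d x y * (b a' - a b') / ((a + b) (a' + b'))\<close>, and \<open>b a' - a b'\<close> is at most \<open>d u v\<close> times either of the
  two sums.  So the slope decays as soon as one end is off the metric segment from \<open>x\<close> to \<open>y\<close>.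
\<close>

lemma peak_fun_slope:
  assumes "x \<in> M" "y \<in> M" "x \<noteq> y" "u \<in> M" "v \<in> M" "s \<le> d u y + d u x \<or> s \<le> d v y + d v x" "s > 0"
  shows "\<bar>peak_fun x y u - peak_fun x y v\<bar> \<le> d x y / s * d u v"
proof -
  define D where "D = d x y"
  define a b a' b' where ab: "a = d u x" "b = d u y" "a' = d v x" "b' = d v y"
  note defs = D_def ab
  have D: "D > 0" using assms by (simp add: D_def)
  have sum: "a + b \<ge> D" "a' + b' \<ge> D"
    using assms triangle[of x u y] triangle[of x v y] commute by (auto simp: defs)
  have nn: "a \<ge> 0" "b \<ge> 0" "a' \<ge> 0" "b' \<ge> 0" by (auto simp: defs)
  have t: "\<bar>a' - a\<bar> \<le> d u v" "\<bar>b - b'\<bar> \<le> d u v"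
    using assms triangle[of u v x] triangle[of v u x] triangle[of u v y] triangle[of v u y] commute[of v u]
    by (auto simp: defs)
  have id: "peak_fun x y u - peak_fun x y v = D * (b * a' - a * b') / ((a + b) * (a' + b'))"
  proof -
    have "b + a \<noteq> 0" "b' + a' \<noteq> 0" using sum D by linarith+
    then have "peak_fun x y u - peak_fun x y v
        = (D / 2 * (b - a) * (b' + a') - D / 2 * (b' - a') * (b + a)) / ((b + a) * (b' + a'))"
      unfolding peak_fun_def defs[symmetric] by (rule diff_frac_eq)
    also have "D / 2 * (b - a) * (b' + a') - D / 2 * (b' - a') * (b + a) = D * (b * a' - a * b')"
      by (simp add: field_simps)
    finally show ?thesis by (simp only: add.commute)
  qed
  have e1: "\<bar>b * a' - a * b'\<bar> \<le> (a + b) * d u v"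
  proof -
    have "\<bar>b * a' - a * b'\<bar> = \<bar>b * (a' - a) + a * (b - b')\<bar>" by (simp add: algebra_simps)
    also have "\<dots> \<le> b * \<bar>a' - a\<bar> + a * \<bar>b - b'\<bar>"
      using nn abs_triangle_ineq[of "b * (a' - a)" "a * (b - b')"] by (simp add: abs_mult)
    also have "\<dots> \<le> b * d u v + a * d u v" using nn t by (intro add_mono mult_left_mono)
    finally show ?thesis by (simp add: algebra_simps)
  qed
  have e2: "\<bar>b * a' - a * b'\<bar> \<le> (a' + b') * d u v"
  proof -
    have "\<bar>b * a' - a * b'\<bar> = \<bar>b' * (a' - a) + a' * (b - b')\<bar>" by (simp add: algebra_simps)
    also have "\<dots> \<le> b' * \<bar>a' - a\<bar> + a' * \<bar>b - b'\<bar>"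
      using nn abs_triangle_ineq[of "b' * (a' - a)" "a' * (b - b')"] by (simp add: abs_mult)
    also have "\<dots> \<le> b' * d u v + a' * d u v" using nn t by (intro add_mono mult_left_mono)
    finally show ?thesis by (simp add: algebra_simps)
  qed
  have pos: "a + b > 0" "a' + b' > 0" using sum D by linarith+
  have "\<bar>b * a' - a * b'\<bar> * s \<le> (a + b) * (a' + b') * d u v"
  proof (cases "s \<le> a + b")
    case True
    then show ?thesis
      using mult_mono[OF e2 True] assms(7) pos by (simp add: mult_ac)
  next
    case False
    then have "s \<le> a' + b'" using assms(6) by (simp add: defs add.commute)
    then show ?thesis
      using mult_mono[OF e1, of s "a' + b'"] assms(7) pos by (simp add: mult_ac)
  qed
  then have "\<bar>b * a' - a * b'\<bar> \<le> (a + b) * (a' + b') * (d u v / s)"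
    using assms(7) by (simp add: pos_le_divide_eq)
  then have "\<bar>b * a' - a * b'\<bar> / ((a + b) * (a' + b')) \<le> d u v / s"
    using pos by (simp add: pos_divide_le_eq mult.commute)
  then have "D * (\<bar>b * a' - a * b'\<bar> / ((a + b) * (a' + b'))) \<le> D * (d u v / s)"
    using D by (intro mult_left_mono) auto
  then show ?thesis unfolding id D_def[symmetric] using D pos by (simp add: abs_mult)
qed

lemma peak_fun_lip1:
  assumes "x \<in> M" "y \<in> M" "x \<noteq> y"
  shows "peak_fun x y \<in> lip1 M d"
proof (rule lip1I[OF _ commute])
  fix u v assume uv: "u \<in> M" "v \<in> M"
  have "d x y > 0" "d x y \<le> d u y + d u x"
    using assms triangle[of x u y] uv commute[of x u] by auto
  with peak_fun_slope[OF assms uv, of "d x y"] show "peak_fun x y u - peak_fun x y v \<le> d u v"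
    by simp
qed

lemma peak_fun_peak:
  assumes "x \<in> M" "y \<in> M" "x \<noteq> y"
  shows "peak_fun x y x - peak_fun x y y = d x y"
  using assms commute[of x y] by (simp add: peak_fun_def)

definition plateau_fun :: "'a \<Rightarrow> 'a \<Rightarrow> real \<Rightarrow> 'a \<Rightarrow> real"
  where "plateau_fun x y r z = max r (min (d z y) (d x y - r))"

lemma plateau_fun_lip1: "y \<in> M \<Longrightarrow> plateau_fun x y r \<in> lip1 M d"
proof (rule lip1I[OF _ commute])
  fix u v assume "y \<in> M" "u \<in> M" "v \<in> M"
  then have "d u y \<le> d u v + d v y" by (intro triangle)
  with nonneg[of u v] show "plateau_fun x y r u - plateau_fun x y r v \<le> d u v"
    unfolding plateau_fun_def by linarith
qed

text \<open>
  Being constant near \<open>x\<close> and near \<open>y\<close>, the function ignores molecules whose two ends are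
  close to the same one of them, whereas \<open>peak_fun\<close> may be as steep there as from \<open>x\<close> to \<open>y\<close>.
\<close>

lemma plateau_fun_near:
  assumes "x \<in> M" "y \<in> M" "u \<in> M" "r \<le> d x y / 2"
  shows "d x u < r \<Longrightarrow> plateau_fun x y r u = d x y - r"
    and "d y u < r \<Longrightarrow> plateau_fun x y r u = r"
  using assms triangle[of x u y] commute[of y u] by (auto simp: plateau_fun_def)

text \<open>
  The functional is tested on \<open>h\<close> plus a multiple of \<open>f - \<theta> F\<close>, where \<open>\<theta>\<close> makes the difference vanish
  on the pair \<open>(x, y)\<close>.  On pairs from near \<open>x\<close> to near \<open>y\<close> the added function is therefore almost flat;
  on all other pairs its slope is absorbed by the reserve \<open>\<tau>\<close> of \<open>h\<close>.
\<close>

lemma lip_functional_perturb: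
  assumes \<Phi>: "lip_functional M d \<Phi>" and M: "x \<in> M" "y \<in> M" "x \<noteq> y"
    and r: "0 < r" "4 * r \<le> d x y" and lam: "0 < \<tau>" "\<tau> \<le> 1/2"
    and h: "h \<in> lip1 M d"
    and far: "\<And>u v. u \<in> M \<Longrightarrow> v \<in> M \<Longrightarrow> \<not> (d x u < r \<and> d y v < r) \<Longrightarrow> h u - h v \<le> (1 - \<tau>) * d u v"
    and F: "F \<in> lip1 M d" "F x - F y = d x y" and f: "f \<in> lip1 M d"
  shows "\<Phi> h + \<tau> / 2 * (\<Phi> f - (f x - f y) / d x y * \<Phi> F) \<le> 1 + \<tau> / 2 * (8 * r / d x y)"
proof -
  define D where "D = d x y"
  have D: "D > 0" using M by (simp add: D_def)
  define \<theta> where "\<theta> = (f x - f y) / D"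
  \<comment> \<open>halved so that it is again 1-Lipschitz\<close>
  define w where "w z = 1/2 * f z + (- \<theta> / 2) * F z" for z
  define L where "L = 1 + \<tau> / 2 * (8 * r / D)"
  have L: "L \<ge> 1" using lam r D by (simp add: L_def)
  have th: "\<bar>\<theta>\<bar> \<le> 1"
    using lip1D[OF f M(1,2)] lip1D[OF f M(2,1)] D commute[of y x]
    by (auto simp: \<theta>_def D_def abs_le_iff field_simps)
  have thF: "\<bar>\<theta> * (F u - F v)\<bar> \<le> d u v" if "u \<in> M" "v \<in> M" for u v
  proof -
    have "\<bar>F u - F v\<bar> \<le> d u v" using F(1) that by (auto simp: lip1_def)
    then show ?thesis using th mult_mono[of "\<bar>\<theta>\<bar>" 1 "\<bar>F u - F v\<bar>" "d u v"] by (simp add: abs_mult)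
  qed
  have w: "w \<in> lip1 M d"
  proof (rule lip1I[OF _ commute])
    fix u v assume uv: "u \<in> M" "v \<in> M"
    define c where "c = \<theta> * (F u - F v)"
    have "w u - w v = 1/2 * (f u - f v) - 1/2 * c" by (simp add: w_def c_def field_simps)
    moreover have "\<bar>c\<bar> \<le> d u v" using thF[OF uv] by (simp only: c_def)
    moreover have "f u - f v \<le> d u v" by (rule lip1D[OF f uv])
    moreover have "1/2 * a - 1/2 * c \<le> t" if "\<bar>c\<bar> \<le> t" "a \<le> t" for a c t :: real
      using that by (simp add: abs_le_iff)
    ultimately show "w u - w v \<le> d u v" by metis
  qed
  have k_lip: "h u - h v + \<tau> * (w u - w v) \<le> L * d u v" if uv: "u \<in> M" "v \<in> M" for u v
  proof (cases "d x u < r \<and> d y v < r")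
    case False
    have "h u - h v + \<tau> * (w u - w v) \<le> (1 - \<tau>) * d u v + \<tau> * d u v"
      using far[OF uv False] lip1D[OF w uv] lam by (intro add_mono mult_left_mono) auto
    also have "\<dots> = 1 * d u v" by (simp add: algebra_simps)
    also have "\<dots> \<le> L * d u v" using L by (intro mult_right_mono) auto
    finally show ?thesis .
  next
    case True
    have "D \<le> d u v + 2 * r"
      using True triangle[of x u y] triangle[of u v y] M uv commute[of v y] by (simp add: D_def)
    then have "D / 2 \<le> d u v" using r by (simp add: D_def)
    have wuv: "w u - w v \<le> 2 * r"
    proof -
      have "w u - w v = (w u - w x) + (w y - w v) + (w x - w y)" by simp
      moreover have "w x - w y = 0"
      proof -
        have "w x - w y = 1/2 * (f x - f y - \<theta> * (F x - F y))" by (simp add: w_def algebra_simps)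
        also have "\<theta> * (F x - F y) = f x - f y" using F(2) D by (simp add: \<theta>_def D_def)
        finally show ?thesis by simp
      qed
      moreover have "w u - w x \<le> r" "w y - w v \<le> r"
        using lip1D[OF w uv(1) M(1)] lip1D[OF w M(2) uv(2)] True commute[of u x] by auto
      ultimately show ?thesis by linarith
    qed
    also have "2 * r \<le> 4 * r / D * d u v"
      using \<open>D / 2 \<le> d u v\<close> D r by (simp add: field_simps)
    finally have "\<tau> * (w u - w v) \<le> \<tau> * (4 * r / D * d u v)" using lam by (intro mult_left_mono) auto
    then show ?thesis using lip1D[OF h uv] by (simp add: L_def algebra_simps)
  qed
  define k where "k z = (1 / L) * h z + (\<tau> / L) * w z" for z
  have k: "k \<in> lip1 M d"
  proof (rule lip1I[OF _ commute])
    fix u v assume uv: "u \<in> M" "v \<in> M"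
    have "k u - k v = (h u - h v + \<tau> * (w u - w v)) / L"
      using L by (simp add: k_def field_simps)
    also have "\<dots> \<le> d u v" using k_lip[OF uv] L by (simp add: divide_le_eq mult.commute)
    finally show "k u - k v \<le> d u v" .
  qed
  have lin: "\<Phi> (\<lambda>z. a * f z + b * g z) = a * \<Phi> f + b * \<Phi> g"
    if "f \<in> lip1 M d" "g \<in> lip1 M d" "(\<lambda>z. a * f z + b * g z) \<in> lip1 M d" for f g a b
    using \<Phi> that unfolding lip_functional_def by blast
  have "\<Phi> k = (1 / L) * \<Phi> h + (\<tau> / L) * \<Phi> w"
    using lin[OF h w] k unfolding k_def by blast
  moreover have "\<Phi> w = 1/2 * \<Phi> f + (- \<theta> / 2) * \<Phi> F"
    using lin[OF f F(1)] w unfolding w_def by blast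
  moreover have "\<Phi> k \<le> 1" using \<Phi> k by (force simp: lip_functional_def)
  ultimately have "((1 / L) * \<Phi> h + (\<tau> / L) * (1/2 * \<Phi> f + (- \<theta> / 2) * \<Phi> F)) * L \<le> 1 * L"
    using L by (intro mult_right_mono) auto
  moreover have "((1 / L) * \<Phi> h + (\<tau> / L) * (1/2 * \<Phi> f + (- \<theta> / 2) * \<Phi> F)) * L
      = \<Phi> h + \<tau> / 2 * (\<Phi> f - \<theta> * \<Phi> F)"
    using L by (simp add: field_simps)
  ultimately show ?thesis by (simp add: L_def \<theta>_def D_def)
qed

text \<open>
  The molecule is within \<open>\<beta>\<close> of the maximum of \<open>h\<close>, and whatever is within \<open>C * \<beta>\<close> of it agrees with the
  molecule up to \<open>e\<close>.  The factor \<open>C\<close> is free because the loss \<open>\<beta> = 2 r \<tau> / d x y\<close> is a small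
  fraction, controlled by \<open>r\<close>, of the reserve \<open>\<tau>\<close> of \<open>h\<close> on other pairs.  So this single
  statement gives small slices (\<open>C = 2\<close>) and also handles ends of segments, where \<open>C\<close> depends on the
  position of the molecule on the segment.
\<close>

lemma concave_pair_slice:
  assumes cp: "concave_pair M d x y" and C: "C \<ge> 1" and e: "e > 0"
  shows "\<exists>h\<in>lip1 M d. \<exists>\<beta>>0. \<beta> \<le> 1/4 \<and> (h x - h y) / d x y \<ge> 1 - \<beta> \<and>
    (\<forall>\<Phi>. lip_functional M d \<Phi> \<longrightarrow> \<Phi> h \<ge> 1 - C * \<beta> \<longrightarrow>
      (\<forall>f\<in>lip1 M d. \<bar>\<Phi> f - (f x - f y) / d x y\<bar> \<le> e))"
proof -
  have M: "x \<in> M" "y \<in> M" "x \<noteq> y" using cp by (auto simp: concave_pair_def)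
  define D where "D = d x y"
  have D: "D > 0" using M by (simp add: D_def)
  \<comment> \<open>the error at the end of the proof is at most \<open>16 C r / D\<close>\<close>
  define r where "r = min (D / 4) (D * e / (16 * C))"
  have r: "0 < r" "4 * r \<le> D" using D C e by (auto simp: r_def)
  have re: "16 * C * r / D \<le> e"
  proof -
    have "r \<le> D * e / (16 * C)" by (simp add: r_def)
    then show ?thesis using D C by (simp add: field_simps)
  qed
  obtain \<delta> where \<delta>: "\<delta> > 0" "\<And>z. z \<in> M \<Longrightarrow> min (d x z) (d y z) \<ge> r \<Longrightarrow> d x z + d z y \<ge> D + \<delta>"
    using cp r(1) unfolding concave_pair_def D_def by meson
  define \<eta> where "\<eta> = \<delta> / (D + \<delta>)"
  have \<eta>: "0 < \<eta>" "\<eta> \<le> 1" "D / (D + \<delta>) = 1 - \<eta>" using \<delta>(1) D by (auto simp: \<eta>_def field_simps)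
  \<comment> \<open>half of the slope that \<open>F\<close> loses away from \<open>x\<close> and \<open>y\<close>: the other half is left as a reserve\<close>
  define \<tau> where "\<tau> = \<eta> / 2"
  have lam: "0 < \<tau>" "\<tau> \<le> 1/2" using \<eta> by (auto simp: \<tau>_def)
  define F where "F = peak_fun x y"
  define g where "g = plateau_fun x y r"
  define h where "h z = (1 - \<tau>) * F z + \<tau> * g z" for z
  have F: "F \<in> lip1 M d" "F x - F y = D"
    unfolding F_def D_def by (rule peak_fun_lip1[OF M], rule peak_fun_peak[OF M])
  have g: "g \<in> lip1 M d" unfolding g_def by (rule plateau_fun_lip1[OF M(2)])
  have hdiff: "h u - h v = (1 - \<tau>) * (F u - F v) + \<tau> * (g u - g v)" for u v
    by (simp add: h_def algebra_simps)
  have h: "h \<in> lip1 M d"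
  proof (rule lip1I[OF _ commute])
    fix u v assume uv: "u \<in> M" "v \<in> M"
    have "h u - h v \<le> (1 - \<tau>) * d u v + \<tau> * d u v"
      unfolding hdiff using lip1D[OF F(1) uv] lip1D[OF g uv] lam by (intro add_mono mult_left_mono) auto
    then show "h u - h v \<le> d u v" by (simp add: algebra_simps)
  qed
  have far: "h u - h v \<le> (1 - \<tau>) * d u v" if uv: "u \<in> M" "v \<in> M" "\<not> (d x u < r \<and> d y v < r)" for u v
  proof -
    have near: "z \<in> M \<Longrightarrow> d x z < r \<Longrightarrow> g z = D - r" "z \<in> M \<Longrightarrow> d y z < r \<Longrightarrow> g z = r" for z
      using plateau_fun_near[OF M(1,2), of z r] r unfolding g_def D_def by auto
    show ?thesis
    proof (cases "(d x u < r \<or> d y u < r) \<and> (d x v < r \<or> d y v < r)")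
      case True
      then have "g u - g v \<le> 0" using near uv r by auto
      then have "\<tau> * (g u - g v) \<le> 0" using lam by (simp add: mult_nonneg_nonpos)
      moreover have "(1 - \<tau>) * (F u - F v) \<le> (1 - \<tau>) * d u v"
        using lip1D[OF F(1) uv(1,2)] lam by (intro mult_left_mono) auto
      ultimately show ?thesis unfolding hdiff by linarith
    next
      case False
      then have "D + \<delta> \<le> d u y + d u x \<or> D + \<delta> \<le> d v y + d v x"
        using \<delta>(2)[OF uv(1)] \<delta>(2)[OF uv(2)] commute[of x u] commute[of x v] by auto
      from peak_fun_slope[OF M uv(1,2) this] have "\<bar>F u - F v\<bar> \<le> D / (D + \<delta>) * d u v"
        using D \<delta>(1) by (simp add: F_def D_def)
      then have "F u - F v \<le> (1 - \<eta>) * d u v" unfolding \<eta>(3) by linarith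
      then have "h u - h v \<le> (1 - \<tau>) * ((1 - \<eta>) * d u v) + \<tau> * d u v"
        unfolding hdiff using lip1D[OF g uv(1,2)] lam by (intro add_mono mult_left_mono) auto
      also have "\<dots> = (1 - \<eta> * (1 - \<tau>)) * d u v" by (simp add: algebra_simps)
      also have "\<dots> \<le> (1 - \<tau>) * d u v"
      proof (rule mult_right_mono)
        have "\<eta> * (1/2) \<le> \<eta> * (1 - \<tau>)" using lam \<eta> by (intro mult_left_mono) auto
        then show "1 - \<eta> * (1 - \<tau>) \<le> 1 - \<tau>" by (simp add: \<tau>_def)
      qed simp
      finally show ?thesis .
    qed
  qed
  define \<beta> where "\<beta> = 2 * r * \<tau> / D"
  have \<beta>: "\<beta> > 0" using r lam D by (simp add: \<beta>_def)
  have \<beta>4: "\<beta> \<le> 1/4"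
  proof -
    have "(2 * r) * \<tau> \<le> (D / 2) * (1/2)" using r lam by (intro mult_mono) auto
    then show ?thesis using D by (simp add: \<beta>_def field_simps)
  qed
  have hm: "(h x - h y) / D \<ge> 1 - \<beta>"
  proof -
    \<comment> \<open>flattening both balls costs \<open>g\<close> exactly \<open>2 r\<close> of its total increase\<close>
    have gxy: "g x = D - r" "g y = r"
      using plateau_fun_near[OF M(1,2), of _ r] M r unfolding g_def D_def by auto
    then have "h x - h y = D - 2 * r * \<tau>" unfolding hdiff F(2) gxy by (simp add: algebra_simps)
    moreover have "(D - 2 * r * \<tau>) / D = 1 - \<beta>" using D by (simp add: \<beta>_def diff_divide_distrib)
    ultimately show ?thesis by simp
  qed
  have "\<bar>\<Phi> f - (f x - f y) / D\<bar> \<le> e"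
    if \<Phi>: "lip_functional M d \<Phi>" and big: "\<Phi> h \<ge> 1 - C * \<beta>" and f: "f \<in> lip1 M d" for \<Phi> f
  proof -
    define \<theta> where "\<theta> = (f x - f y) / D"
    have th: "\<bar>\<theta>\<bar> \<le> 1"
      using lip1D[OF f M(1,2)] lip1D[OF f M(2,1)] D commute[of y x]
      by (auto simp: \<theta>_def D_def abs_le_iff field_simps)
    have le1: "\<bar>\<Phi> f'\<bar> \<le> 1" if "f' \<in> lip1 M d" for f'
      using \<Phi> that by (simp add: lip_functional_def)
    have est: "\<Phi> f' - (f' x - f' y) / D * \<Phi> F \<le> 12 * C * r / D" if f': "f' \<in> lip1 M d" for f'
    proof -
      have "\<Phi> h + \<tau> / 2 * (\<Phi> f' - (f' x - f' y) / D * \<Phi> F) \<le> 1 + \<tau> / 2 * (8 * r / D)"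
        using lip_functional_perturb[OF \<Phi> M r(1) _ lam h far F(1) _ f'] r(2) F(2)
        by (simp add: D_def)
      then have "\<tau> / 2 * (\<Phi> f' - (f' x - f' y) / D * \<Phi> F) \<le> \<tau> / 2 * (8 * r / D) + C * \<beta>"
        using big by linarith
      also have "\<dots> = \<tau> / 2 * (8 * r / D + 4 * C * r / D)"
        using D by (simp add: \<beta>_def field_simps)
      finally have "\<Phi> f' - (f' x - f' y) / D * \<Phi> F \<le> 8 * r / D + 4 * C * r / D"
        using lam by simp
      also have "\<dots> \<le> 8 * C * r / D + 4 * C * r / D"
        using C r D by (simp add: field_simps)
      finally show ?thesis by (simp add: field_simps)
    qed
    have neg: "(\<lambda>z. (-1) * f z + 0 * f z) \<in> lip1 M d"
      using f by (auto simp: lip1_def abs_minus_commute)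
    then have "\<Phi> (\<lambda>z. (-1) * f z + 0 * f z) = (-1) * \<Phi> f + 0 * \<Phi> f"
      using \<Phi> f unfolding lip_functional_def by blast
    moreover have "((-1) * f x + 0 * f x - ((-1) * f y + 0 * f y)) / D = - \<theta>"
      by (simp add: \<theta>_def diff_divide_distrib)
    ultimately have "- \<Phi> f + \<theta> * \<Phi> F \<le> 12 * C * r / D" using est[OF neg] by simp
    moreover have "\<Phi> f - \<theta> * \<Phi> F \<le> 12 * C * r / D" using est[OF f] by (simp add: \<theta>_def)
    ultimately have fF: "\<bar>\<Phi> f - \<theta> * \<Phi> F\<bar> \<le> 12 * C * r / D" by (simp add: abs_le_iff)
    have "\<Phi> h = (1 - \<tau>) * \<Phi> F + \<tau> * \<Phi> g"
      using \<Phi> F(1) g h unfolding lip_functional_def h_def by blast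
    also have "\<dots> \<le> (1 - \<tau>) * \<Phi> F + \<tau> * 1"
      using le1[OF g] lam by (intro add_left_mono mult_left_mono) auto
    finally have "(1 - \<tau>) * (1 - \<Phi> F) \<le> C * \<beta>" using big by (simp add: algebra_simps)
    moreover have "1/2 * (1 - \<Phi> F) \<le> (1 - \<tau>) * (1 - \<Phi> F)"
      using le1[OF F(1)] lam by (intro mult_right_mono) auto
    moreover have "C * \<beta> \<le> C * (r / D)"
    proof (rule mult_left_mono)
      have "2 * r * \<tau> \<le> 2 * r * (1/2)" using r lam by (intro mult_left_mono) auto
      then show "\<beta> \<le> r / D" using D by (simp add: \<beta>_def field_simps)
    qed (use C in simp)
    ultimately have "\<bar>\<Phi> F - 1\<bar> \<le> 2 * C * r / D" using le1[OF F(1)] by simp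
    then have tF: "\<bar>\<theta> * (\<Phi> F - 1)\<bar> \<le> 2 * C * r / D"
      using mult_mono[OF th, of "\<bar>\<Phi> F - 1\<bar>" "2 * C * r / D"] by (simp add: abs_mult)
    have "\<bar>\<Phi> f - \<theta>\<bar> \<le> \<bar>\<Phi> f - \<theta> * \<Phi> F\<bar> + \<bar>\<theta> * (\<Phi> F - 1)\<bar>"
      using abs_triangle_ineq[of "\<Phi> f - \<theta> * \<Phi> F" "\<theta> * (\<Phi> F - 1)"]
      by (simp add: algebra_simps)
    also have "\<dots> \<le> 12 * C * r / D + 2 * C * r / D"
      by (rule add_mono[OF fF tF])
    also have "\<dots> \<le> 16 * C * r / D" using C r D by (simp add: field_simps)
    finally show ?thesis using re by (simp add: \<theta>_def)
  qed
  then show ?thesis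
    using h \<beta> \<beta>4 hm unfolding D_def by blast
qed

end

section \<open>The dual and the bidual of the free space\<close>

lemma free_space_combination:
  assumes u: "u \<in> free_space M d" and f: "f \<in> lip1 M d" and g: "g \<in> lip1 M d"
    and k: "(\<lambda>z. a * f z + b * g z) \<in> lip1 M d"
  shows "u (\<lambda>z. a * f z + b * g z) = a * u f + b * u g"
proof -
  let ?k = "\<lambda>z. a * f z + b * g z"
  have "\<bar>u ?k - (a * u f + b * u g)\<bar> \<le> e" if "e > 0" for e
  proof -
    let ?e = "e / (1 + \<bar>a\<bar> + \<bar>b\<bar>)"
    have "?e > 0" using that by (intro divide_pos_pos) linarith+
    then obtain x where x: "\<forall>f\<in>lip1 M d. \<bar>u f - free_embed M d x f\<bar> \<le> ?e"
      using u unfolding free_space_def by blast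
    let ?p = "pairing x"
    have near: "\<bar>u q - ?p q\<bar> \<le> ?e" if "q \<in> lip1 M d" for q
      using x that by (force simp: free_embed_def)
    have "?p ?k = a * ?p f + b * ?p g"
      by (simp add: pairing_def sum_distrib_left sum.distrib algebra_simps)
    then have eq: "u ?k - (a * u f + b * u g) = (u ?k - ?p ?k) - a * (u f - ?p f) - b * (u g - ?p g)"
      by (simp add: algebra_simps)
    have "\<bar>u ?k - (a * u f + b * u g)\<bar> \<le> \<bar>u ?k - ?p ?k\<bar> + \<bar>a\<bar> * \<bar>u f - ?p f\<bar> + \<bar>b\<bar> * \<bar>u g - ?p g\<bar>"
    proof -
      have "\<bar>p - q - r\<bar> \<le> \<bar>p\<bar> + \<bar>q\<bar> + \<bar>r\<bar>" for p q r :: real by linarith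
      then show ?thesis unfolding eq abs_mult[symmetric] .
    qed
    also have "\<dots> \<le> ?e + \<bar>a\<bar> * ?e + \<bar>b\<bar> * ?e"
      by (intro add_mono mult_left_mono near f g k abs_ge_zero)
    also have "\<dots> = (1 + \<bar>a\<bar> + \<bar>b\<bar>) * ?e" by (simp only: distrib_right mult_1)
    also have "\<dots> = e"
    proof -
      have "1 + \<bar>a\<bar> + \<bar>b\<bar> \<noteq> 0" by linarith
      then show ?thesis by simp
    qed
    finally show ?thesis .
  qed
  then have "\<bar>u ?k - (a * u f + b * u g)\<bar> \<le> 0" by (rule field_le_epsilon[of _ 0, simplified]) auto
  then show ?thesis by simp
qed

lemma free_space_outside: "u \<in> free_space M d \<Longrightarrow> f \<notin> lip1 M d \<Longrightarrow> u f = 0"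
  by (simp add: free_space_def)

text \<open>
  The functional on the free space given by a Lipschitz function, extended by 0 as the explicit
  carrier of the dual demands.
\<close>

definition eval_at :: "'a set \<Rightarrow> ('a \<Rightarrow> 'a \<Rightarrow> real) \<Rightarrow> ('a \<Rightarrow> real) \<Rightarrow> (('a \<Rightarrow> real) \<Rightarrow> real) \<Rightarrow> real"
  where "eval_at M d f u = (if u \<in> free_space M d then u f else 0)"

lemma linear_on_eval_at: "linear_on (free_space M d) (eval_at M d f)"
  by (simp add: linear_on_def eval_at_def
      subspace_add[OF subspace_free_space] subspace_scale[OF subspace_free_space])

lemma subspace_dual:
  assumes "subspace X"
  shows "subspace (dual X N)"
proof (rule subspaceI)
  show "0 \<in> dual X N"
    by (auto simp: dual_def linear_on_def intro!: exI[of _ 0])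
next
  fix \<phi> \<psi> assume "\<phi> \<in> dual X N" "\<psi> \<in> dual X N"
  then obtain K L where K: "\<forall>x\<in>X. \<bar>\<phi> x\<bar> \<le> K * N x" "\<forall>x\<in>X. \<bar>\<psi> x\<bar> \<le> L * N x"
    and *: "linear_on X \<phi>" "linear_on X \<psi>" "\<forall>x. x \<notin> X \<longrightarrow> \<phi> x = 0" "\<forall>x. x \<notin> X \<longrightarrow> \<psi> x = 0"
    unfolding dual_def by blast
  have "\<bar>(\<phi> + \<psi>) x\<bar> \<le> (K + L) * N x" if "x \<in> X" for x
    using bspec[OF K(1) that] bspec[OF K(2) that] by (simp add: distrib_right)
  moreover have "linear_on X (\<phi> + \<psi>)"
    using * by (simp add: linear_on_def distrib_left)
  ultimately show "\<phi> + \<psi> \<in> dual X N"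
    unfolding dual_def by (intro CollectI conjI exI[of _ "K + L"] ballI allI impI) (use * in auto)
next
  fix c \<phi> assume "\<phi> \<in> dual X N"
  then obtain K where K: "\<forall>x\<in>X. \<bar>\<phi> x\<bar> \<le> K * N x"
    and *: "linear_on X \<phi>" "\<forall>x. x \<notin> X \<longrightarrow> \<phi> x = 0"
    unfolding dual_def by blast
  have "\<bar>(c *\<^sub>R \<phi>) x\<bar> \<le> (\<bar>c\<bar> * K) * N x" if "x \<in> X" for x
    using mult_left_mono[OF bspec[OF K that], of "\<bar>c\<bar>"] by (simp add: abs_mult mult.assoc)
  moreover have "linear_on X (c *\<^sub>R \<phi>)"
    using * by (simp add: linear_on_def distrib_left)
  ultimately show "c *\<^sub>R \<phi> \<in> dual X N"
    unfolding dual_def by (intro CollectI conjI exI[of _ "\<bar>c\<bar> * K"] ballI allI impI) (use * in auto)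
qed

context Metric_space
begin

abbreviation "FS \<equiv> free_space M d"
abbreviation "FN \<equiv> free_norm M d"
abbreviation "mol \<equiv> molecule M d"

lemmas free_norm_le = free_norm_le_iff[OF Metric_space_axioms]

lemma abs_le_free_norm: "u \<in> FS \<Longrightarrow> f \<in> lip1 M d \<Longrightarrow> \<bar>u f\<bar> \<le> FN u"
  using free_norm_le[of u "FN u"] by simp

lemma free_norm_nonneg: "u \<in> FS \<Longrightarrow> 0 \<le> FN u"
  using abs_le_free_norm[OF _ lip1_zero[OF Metric_space_axioms]] by force

lemma free_norm_0: "FN 0 = 0"
  using free_norm_nonneg[OF subspace_0[OF subspace_free_space]]
    free_norm_le[OF subspace_0[OF subspace_free_space], of 0] by simp

lemma free_norm_eq_0: "u \<in> FS \<Longrightarrow> FN u = 0 \<Longrightarrow> u = 0"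
  using abs_le_free_norm[of u] free_space_outside[of u] by (fastforce simp: fun_eq_iff)

lemma lip_functional_free_space:
  assumes "u \<in> FS" "FN u \<le> 1"
  shows "lip_functional M d u"
  unfolding lip_functional_def
  using assms free_norm_le[OF assms(1)] free_space_combination[OF assms(1)] by blast

lemma molecule_eq:
  assumes "x \<in> M" "y \<in> M"
  shows "mol x y = (1 / d x y) *\<^sub>R free_embed M d (point_diff x y)"
proof -
  have "(\<lambda>m. (indicator {x} m - indicator {y} m) / d x y) = (1 / d x y) *\<^sub>R point_diff x y"
    by (simp add: point_diff_def fun_eq_iff)
  then show ?thesis
    using linear_onD(2)[OF free_embed_linear point_diff_in_pre_free[OF assms]]
    by (simp add: molecule_def)
qed

lemma molecule_apply:
  assumes "x \<in> M" "y \<in> M"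
  shows "mol x y f = (if f \<in> lip1 M d then (f x - f y) / d x y else 0)"
  by (simp add: molecule_eq[OF assms] free_embed_def pairing_point_diff)

lemma molecule_swap: "x \<in> M \<Longrightarrow> y \<in> M \<Longrightarrow> mol y x = - mol x y"
  using commute[of x y] by (simp add: fun_eq_iff molecule_apply minus_divide_left)

lemma molecule_in: "x \<in> M \<Longrightarrow> y \<in> M \<Longrightarrow> mol x y \<in> FS"
  by (simp add: molecule_eq subspace_scale[OF subspace_free_space] free_embed_in point_diff_in_pre_free)

lemma free_norm_molecule:
  assumes "x \<in> M" "y \<in> M" "x \<noteq> y"
  shows "FN (mol x y) = 1"
proof (rule antisym)
  have D: "d x y > 0" using assms by simp
  have "\<bar>f x - f y\<bar> \<le> d x y" if "f \<in> lip1 M d" for f using that assms by (simp add: lip1_def)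
  then show "FN (mol x y) \<le> 1"
    using D by (simp add: free_norm_le[OF molecule_in[OF assms(1,2)]] molecule_apply assms)
  show "1 \<le> FN (mol x y)"
    using abs_le_free_norm[OF molecule_in[OF assms(1,2)] lip1_dist[OF assms(2)]] D
    by (simp add: molecule_apply assms lip1_dist)
qed

lemma eval_at_dual: "f \<in> lip1 M d \<Longrightarrow> eval_at M d f \<in> dual FS FN"
  using linear_on_eval_at[of M d f] abs_le_free_norm[of _ f]
  by (auto simp: dual_def eval_at_def intro!: exI[of _ 1])

text \<open>
  The dual of the free space consists of Lipschitz functions: the values on differences to a base point
  determine the function, and density of the finitely supported elements does the rest.
\<close>

lemma dual_eq_eval_at:
  assumes lin: "linear_on FS \<phi>" and K: "K > 0" "\<And>u. u \<in> FS \<Longrightarrow> \<bar>\<phi> u\<bar> \<le> K * FN u" and p: "p \<in> M"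
  shows "\<exists>f\<in>lip1 M d. \<forall>u\<in>FS. \<phi> u = K * u f"
proof -
  define f where "f z = \<phi> (free_embed M d (point_diff z p)) / K" for z
  let ?P = "pre_free M" and ?e = "free_embed M d"
  have lin': "linear_on ?P (\<lambda>u. \<phi> (?e u))"
    using lin free_embed_linear[of M d] free_embed_in[of _ M d] by (simp add: linear_on_def)
  have f: "f \<in> lip1 M d"
  proof (rule lip1I[OF _ commute])
    fix u v assume uv: "u \<in> M" "v \<in> M"
    let ?q = "point_diff u v"
    have q: "?q \<in> ?P" using uv by (rule point_diff_in_pre_free)
    have "\<bar>h u - h v\<bar> \<le> d u v" if "h \<in> lip1 M d" for h
      using that uv by (simp add: lip1_def)
    then have "FN (?e ?q) \<le> d u v"
      unfolding free_norm_le[OF free_embed_in[OF q]] by (simp add: free_embed_def pairing_point_diff)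
    then have le: "\<bar>\<phi> (?e ?q)\<bar> \<le> K * d u v"
      using K(2)[OF free_embed_in[OF q]] K(1) by (meson mult_le_cancel_left_pos order_trans)
    have "?q = point_diff u p - point_diff v p" by (simp add: point_diff_def fun_eq_iff)
    then have "\<phi> (?e ?q) = K * f u - K * f v"
      using linear_on_diff[OF lin' subspace_pre_free point_diff_in_pre_free[OF uv(1) p]
          point_diff_in_pre_free[OF uv(2) p]] K(1) by (simp add: f_def)
    then have "K * (f u - f v) \<le> K * d u v" using le by (simp add: algebra_simps)
    then show "f u - f v \<le> d u v" using K(1) by simp
  qed
  have emb: "\<phi> (?e x) = K * ?e x f" if x: "x \<in> ?P" for x
  proof -
    have "\<phi> (?e x) = pairing x (\<lambda>m. \<phi> (?e (point_diff m p)))"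
      by (rule linear_functional_pre_free[OF lin' x p])
    also have "\<dots> = K * pairing x f" using K(1) by (simp add: pairing_def f_def sum_distrib_left)
    finally show ?thesis using f by (simp add: free_embed_def)
  qed
  have "\<phi> u = K * u f" if u: "u \<in> FS" for u
  proof -
    have "\<bar>\<phi> u - K * u f\<bar> \<le> e" if e: "e > 0" for e
    proof -
      have "e / (2 * K) > 0" using e K by simp
      then obtain x where x: "x \<in> ?P" "FN (u - ?e x) \<le> e / (2 * K)"
        using free_embed_dense[OF Metric_space_axioms u] by blast
      note ex = free_embed_in[OF x(1), of d]
      have D: "u - ?e x \<in> FS" by (rule subspace_diff[OF subspace_free_space u ex])
      have "\<bar>\<phi> u - \<phi> (?e x)\<bar> \<le> K * FN (u - ?e x)"
        using K(2)[OF D] linear_on_diff[OF lin subspace_free_space u ex] by simp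
      also have "\<dots> \<le> K * (e / (2 * K))" using x(2) K by (intro mult_left_mono) auto
      also have "\<dots> = e / 2" using K by simp
      finally have 1: "\<bar>\<phi> u - \<phi> (?e x)\<bar> \<le> e / 2" .
      have "\<bar>K * u f - K * ?e x f\<bar> = K * \<bar>(u - ?e x) f\<bar>"
        using K by (simp add: abs_mult flip: right_diff_distrib)
      also have "\<dots> \<le> K * (e / (2 * K))"
        using x(2) K abs_le_free_norm[OF D f] by (intro mult_left_mono) auto
      also have "\<dots> = e / 2" using K by simp
      finally show ?thesis using 1 emb[OF x(1)] by linarith
    qed
    then have "\<bar>\<phi> u - K * u f\<bar> \<le> 0" by (rule field_le_epsilon[of _ 0, simplified]) auto
    then show ?thesis by simp
  qed
  with f show ?thesis by blast
qed

lemma dual_eq_scaled_eval_at: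
  assumes "\<phi> \<in> dual FS FN" "p \<in> M"
  shows "\<exists>f\<in>lip1 M d. \<exists>K. \<phi> = K *\<^sub>R eval_at M d f"
proof -
  obtain K where K: "\<forall>u\<in>FS. \<bar>\<phi> u\<bar> \<le> K * FN u" and lin: "linear_on FS \<phi>"
    and out: "\<forall>u. u \<notin> FS \<longrightarrow> \<phi> u = 0"
    using assms unfolding dual_def by blast
  have "\<bar>\<phi> u\<bar> \<le> (\<bar>K\<bar> + 1) * FN u" if "u \<in> FS" for u
    using bspec[OF K that] mult_right_mono[of K "\<bar>K\<bar> + 1" "FN u"] free_norm_nonneg[OF that] by linarith
  moreover have "\<bar>K\<bar> + 1 > 0" by simp
  ultimately obtain f where "f \<in> lip1 M d" "\<forall>u\<in>FS. \<phi> u = (\<bar>K\<bar> + 1) * u f"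
    using dual_eq_eval_at[OF lin _ _ assms(2)] by blast
  then show ?thesis
    using out by (intro bexI[of _ f] exI[of _ "\<bar>K\<bar> + 1"]) (auto simp: eval_at_def fun_eq_iff)
qed

lemma abs_le_dual_norm:
  assumes "\<phi> \<in> dual FS FN" "u \<in> FS" "FN u \<le> 1"
  shows "\<bar>\<phi> u\<bar> \<le> dual_norm FS FN \<phi>"
proof -
  obtain K where K: "\<forall>u\<in>FS. \<bar>\<phi> u\<bar> \<le> K * FN u" using assms unfolding dual_def by blast
  have "\<bar>\<phi> v\<bar> \<le> \<bar>K\<bar>" if v: "v \<in> FS" "FN v \<le> 1" for v
  proof -
    have "K * FN v \<le> \<bar>K\<bar> * 1"
      using v free_norm_nonneg[OF v(1)] by (intro mult_mono) auto
    then show ?thesis using bspec[OF K v(1)] by simp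
  qed
  then have "bdd_above ((\<lambda>u. \<bar>\<phi> u\<bar>) ` {u \<in> FS. FN u \<le> 1})"
    by (auto simp: bdd_above_def)
  then show ?thesis unfolding dual_norm_def using assms by (intro cSUP_upper) auto
qed

lemma dual_norm_eval_at: "f \<in> lip1 M d \<Longrightarrow> dual_norm FS FN (eval_at M d f) \<le> 1"
  unfolding dual_norm_def
proof (rule cSUP_least)
  show "{u \<in> FS. FN u \<le> 1} \<noteq> {}"
    using subspace_0[OF subspace_free_space[of M d]] free_norm_0 by force
qed (use abs_le_free_norm in \<open>fastforce simp: eval_at_def\<close>)

lemma to_bidual_in_ball:
  assumes "u \<in> FS" "FN u \<le> 1"
  shows "to_bidual FS FN u \<in> bidual_ball FS FN"
proof -
  let ?D = "dual FS FN" and ?DN = "dual_norm FS FN"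
  note sD = subspace_dual[OF subspace_free_space[of M d], of FN]
  have "linear_on ?D (to_bidual FS FN u)"
    using subspace_add[OF sD] subspace_scale[OF sD] by (auto simp: linear_on_def to_bidual_def)
  moreover have le: "\<bar>to_bidual FS FN u \<phi>\<bar> \<le> 1 * ?DN \<phi>" if "\<phi> \<in> ?D" for \<phi>
    using abs_le_dual_norm[OF that assms] that by (simp add: to_bidual_def)
  ultimately have "to_bidual FS FN u \<in> dual ?D ?DN"
    unfolding dual_def[of ?D] by (auto simp: to_bidual_def intro!: exI[of _ 1])
  moreover have "dual_norm ?D ?DN (to_bidual FS FN u) \<le> 1"
    unfolding dual_norm_def[of ?D]
  proof (rule cSUP_least)
    have "(0 :: (('a \<Rightarrow> real) \<Rightarrow> real) \<Rightarrow> real) \<in> ?D" by (rule subspace_0[OF sD])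
    moreover have "?DN 0 \<le> 1"
      unfolding dual_norm_def by (rule cSUP_least) (use assms in auto)
    ultimately show "{\<phi> \<in> ?D. ?DN \<phi> \<le> 1} \<noteq> {}" by blast
  next
    fix \<phi> assume "\<phi> \<in> {\<phi> \<in> ?D. ?DN \<phi> \<le> 1}"
    then show "\<bar>to_bidual FS FN u \<phi>\<bar> \<le> 1" using le by force
  qed
  ultimately show ?thesis by (simp add: bidual_ball_def)
qed

lemma lip_functional_bidual:
  assumes "\<Phi> \<in> bidual_ball FS FN"
  shows "lip_functional M d (\<lambda>f. \<Phi> (eval_at M d f))"
proof -
  let ?D = "dual FS FN" and ?DN = "dual_norm FS FN"
  have lin: "linear_on ?D \<Phi>" and le: "dual_norm ?D ?DN \<Phi> \<le> 1"
    using assms by (auto simp: bidual_ball_def dual_def[of ?D])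
  obtain K where K: "\<forall>\<phi>\<in>?D. \<bar>\<Phi> \<phi>\<bar> \<le> K * ?DN \<phi>"
    using assms unfolding bidual_ball_def dual_def[of ?D] by blast
  have DN0: "0 \<le> ?DN \<phi>" if "\<phi> \<in> ?D" for \<phi>
    using abs_le_dual_norm[OF that subspace_0[OF subspace_free_space]] free_norm_0 by force
  have "\<bar>\<Phi> \<phi>\<bar> \<le> \<bar>K\<bar>" if v: "\<phi> \<in> ?D" "?DN \<phi> \<le> 1" for \<phi>
  proof -
    have "K * ?DN \<phi> \<le> \<bar>K\<bar> * 1"
      using v DN0[OF v(1)] by (intro mult_mono) auto
    then show ?thesis using bspec[OF K v(1)] by simp
  qed
  then have bdd: "bdd_above ((\<lambda>u. \<bar>\<Phi> u\<bar>) ` {\<phi> \<in> ?D. ?DN \<phi> \<le> 1})"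
    by (auto simp: bdd_above_def)
  have "\<bar>\<Phi> (eval_at M d f)\<bar> \<le> 1" if f: "f \<in> lip1 M d" for f
  proof -
    have "\<bar>\<Phi> (eval_at M d f)\<bar> \<le> dual_norm ?D ?DN \<Phi>"
      unfolding dual_norm_def[of ?D]
      using eval_at_dual[OF f] dual_norm_eval_at[OF f] bdd by (intro cSUP_upper) auto
    with le show ?thesis by linarith
  qed
  moreover have "\<Phi> (eval_at M d (\<lambda>z. a * f z + b * g z))
      = a * \<Phi> (eval_at M d f) + b * \<Phi> (eval_at M d g)"
    if fg: "f \<in> lip1 M d" "g \<in> lip1 M d" "(\<lambda>z. a * f z + b * g z) \<in> lip1 M d" for f g a b
  proof -
    note sD = subspace_dual[OF subspace_free_space[of M d], of FN]
    have "eval_at M d (\<lambda>z. a * f z + b * g z) = a *\<^sub>R eval_at M d f + b *\<^sub>R eval_at M d g"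
      using free_space_combination[OF _ fg] by (auto simp: eval_at_def fun_eq_iff)
    then show ?thesis
      using linear_onD[OF lin] eval_at_dual fg subspace_scale[OF sD] by simp
  qed
  ultimately show ?thesis unfolding lip_functional_def by (intro conjI ballI allI impI)
qed

text \<open>
  If the molecule is \<open>(1 - s) \<Phi> + s \<Psi>\<close> and almost maximises \<open>h\<close>, then so does \<open>\<Phi>\<close>, with a loss
  larger by the factor \<open>1 / (1 - s)\<close> at most.
\<close>

lemma segment_end_at_concave_molecule:
  assumes cp: "concave_pair M d x y"
    and \<Phi>: "\<Phi> \<in> bidual_ball FS FN" and \<Psi>: "\<Psi> \<in> bidual_ball FS FN"
    and s: "0 \<le> s" "s < 1"
    and eq: "to_bidual FS FN (mol x y) = (1 - s) *\<^sub>R \<Phi> + s *\<^sub>R \<Psi>"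
  shows "\<Phi> = to_bidual FS FN (mol x y)"
proof -
  have M: "x \<in> M" "y \<in> M" "x \<noteq> y" using cp by (auto simp: concave_pair_def)
  note lf = lip_functional_bidual[OF \<Phi>] and lg = lip_functional_bidual[OF \<Psi>]
  have val: "to_bidual FS FN (mol x y) (eval_at M d f) = (f x - f y) / d x y" if "f \<in> lip1 M d" for f
    using that M by (simp add: to_bidual_def eval_at_dual eval_at_def molecule_in molecule_apply)
  have ev: "\<Phi> (eval_at M d f) = (f x - f y) / d x y" if f: "f \<in> lip1 M d" for f
  proof -
    have "\<bar>\<Phi> (eval_at M d f) - (f x - f y) / d x y\<bar> \<le> e" if "e > 0" for e
    proof -
      have "1 / (1 - s) \<ge> 1" using s by simp
      from concave_pair_slice[OF cp this that] obtain h \<beta> where h: "h \<in> lip1 M d"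
        "(h x - h y) / d x y \<ge> 1 - \<beta>"
        "\<And>\<Phi>. lip_functional M d \<Phi> \<Longrightarrow> \<Phi> h \<ge> 1 - 1 / (1 - s) * \<beta> \<Longrightarrow>
            \<forall>f\<in>lip1 M d. \<bar>\<Phi> f - (f x - f y) / d x y\<bar> \<le> e"
        by blast
      have "1 - \<beta> \<le> (1 - s) * \<Phi> (eval_at M d h) + s * \<Psi> (eval_at M d h)"
        using h(2) val[OF h(1)] unfolding eq by simp
      also have "\<dots> \<le> (1 - s) * \<Phi> (eval_at M d h) + s * 1"
        using lg h(1) s by (intro add_left_mono mult_left_mono) (force simp: lip_functional_def)+
      finally have "\<Phi> (eval_at M d h) \<ge> 1 - 1 / (1 - s) * \<beta>"
        using s by (simp add: field_simps)
      from h(3)[OF lf this] f show ?thesis by blast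
    qed
    then have "\<bar>\<Phi> (eval_at M d f) - (f x - f y) / d x y\<bar> \<le> 0"
      by (rule field_le_epsilon[of _ 0, simplified]) auto
    then show ?thesis by simp
  qed
  show ?thesis
  proof
    fix \<phi>
    show "\<Phi> \<phi> = to_bidual FS FN (mol x y) \<phi>"
    proof (cases "\<phi> \<in> dual FS FN")
      case True
      then obtain f K where f: "f \<in> lip1 M d" "\<phi> = K *\<^sub>R eval_at M d f"
        using dual_eq_scaled_eval_at M by blast
      have "linear_on (dual FS FN) \<Psi>" if "\<Psi> \<in> bidual_ball FS FN" for \<Psi>
        using that by (simp add: bidual_ball_def dual_def[of "dual FS FN"])
      then have lin: "linear_on (dual FS FN) \<Phi>" "linear_on (dual FS FN) (to_bidual FS FN (mol x y))"
        using \<Phi> to_bidual_in_ball[OF molecule_in[OF M(1,2)]] free_norm_molecule[OF M] by auto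
      note ef = eval_at_dual[OF f(1)]
      show ?thesis
        unfolding f(2) linear_onD(2)[OF lin(1) ef] linear_onD(2)[OF lin(2) ef]
        by (simp add: ev[OF f(1)] val[OF f(1)])
    next
      case False
      then show ?thesis
        using \<Phi> by (simp add: to_bidual_def bidual_ball_def dual_def[of "dual FS FN"])
    qed
  qed
qed

lemma concave_pair_E_ext:
  assumes cp: "concave_pair M d x y"
  shows "(x, y) \<in> E_ext M d"
proof -
  let ?m = "to_bidual FS FN (mol x y)"
  have M: "x \<in> M" "y \<in> M" "x \<noteq> y" using cp by (auto simp: concave_pair_def)
  have "?m extreme_point_of bidual_ball FS FN"
    unfolding extreme_point_of_def
  proof (intro conjI ballI notI)
    show "?m \<in> bidual_ball FS FN"
      using to_bidual_in_ball[OF molecule_in[OF M(1,2)]] free_norm_molecule[OF M] by simp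
    fix \<Phi> \<Psi> assume ball: "\<Phi> \<in> bidual_ball FS FN" "\<Psi> \<in> bidual_ball FS FN"
      and seg: "?m \<in> open_segment \<Phi> \<Psi>"
    obtain s where s: "0 < s" "s < 1" "?m = (1 - s) *\<^sub>R \<Phi> + s *\<^sub>R \<Psi>" and ne: "\<Phi> \<noteq> \<Psi>"
      using seg unfolding in_segment by blast
    have s': "?m = (1 - (1 - s)) *\<^sub>R \<Psi> + (1 - s) *\<^sub>R \<Phi>"
      using s(3) by (simp add: add.commute)
    have "\<Phi> = ?m" using segment_end_at_concave_molecule[OF cp ball _ s(2,3)] s(1) by simp
    moreover have "\<Psi> = ?m" using segment_end_at_concave_molecule[OF cp ball(2,1) _ _ s'] s by simp
    ultimately show False using ne by simp
  qed
  with M show ?thesis by (simp add: E_ext_def)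
qed

end

section \<open>Images of molecules under isometries\<close>

context Metric_space
begin

text \<open>
  A tent of height and radius \<open>min (d x y) (d x z)\<close> at \<open>x\<close> vanishes at \<open>y\<close> and \<open>z\<close> and is nonnegative at \<open>w\<close>,
  so it separates the molecules by its height divided by \<open>d x y\<close>.
\<close>

lemma molecules_near_endpoints:
  assumes M: "x \<in> M" "y \<in> M" "x \<noteq> y" "z \<in> M" "w \<in> M" "z \<noteq> w"
    and e: "e < 1" and near: "\<And>f. f \<in> lip1 M d \<Longrightarrow> \<bar>mol x y f - mol z w f\<bar> \<le> e"
  shows "d x z \<le> e * d x y"
proof (cases "x = z")
  case True
  have "0 \<le> e" using near[OF lip1_zero[OF Metric_space_axioms]] by linarith
  then show ?thesis using True M by simp
next
  case False
  define r where "r = min (d x y) (d x z)"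
  have pos: "d x y > 0" "d z w > 0" "r > 0" using M False by (auto simp: r_def)
  define f where "f p = max 0 (r - d p x)" for p
  have f: "f \<in> lip1 M d"
  proof (rule lip1I[OF _ commute])
    fix u v assume "u \<in> M" "v \<in> M"
    then have "d v x \<le> d v u + d u x" using M by (intro triangle)
    with nonneg[of u v] show "f u - f v \<le> d u v"
      unfolding f_def commute[of v u] by linarith
  qed
  have vals: "f x = r" "f y = 0" "f z = 0" "f w \<ge> 0"
    using M pos commute[of x y] commute[of x z] by (auto simp: f_def r_def)
  have "mol x y f = r / d x y" using M f vals by (simp add: molecule_apply)
  moreover have "mol z w f \<le> 0" using M f vals pos by (simp add: molecule_apply)
  ultimately have "r / d x y \<le> e" using abs_le_D1[OF near[OF f]] by simp
  then have r: "r \<le> e * d x y" using pos by (simp add: divide_le_eq)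
  have "e * d x y < 1 * d x y" using e pos by (intro mult_strict_right_mono)
  then have "r < d x y" using r by simp
  then have "r = d x z" by (auto simp: r_def min_def split: if_splits)
  with r show ?thesis by simp
qed

lemma molecules_near_both_endpoints:
  assumes M: "x \<in> M" "y \<in> M" "x \<noteq> y" "z \<in> M" "w \<in> M" "z \<noteq> w"
    and e: "e < 1" and near: "\<And>f. f \<in> lip1 M d \<Longrightarrow> \<bar>mol x y f - mol z w f\<bar> \<le> e"
  shows "d x z \<le> e * d x y" "d y w \<le> e * d x y"
proof -
  show "d x z \<le> e * d x y" by (rule molecules_near_endpoints[OF assms])
  have "\<bar>mol y x f - mol w z f\<bar> \<le> e" if "f \<in> lip1 M d" for f
    using near[OF that] M by (simp add: molecule_swap[of x y] molecule_swap[of z w] abs_minus_commute)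
  then have "d y w \<le> e * d y x"
    using molecules_near_endpoints[OF M(2,1) M(3)[symmetric] M(5,4) M(6)[symmetric] e] by blast
  then show "d y w \<le> e * d x y" by (simp only: commute[of y x])
qed

text \<open>
  Close molecules have close ends relative to their distance, so along an approximating
  sequence the distances of the ends stay between \<open>D / 2\<close> and \<open>2 * D\<close>, and both sequences of ends are
  Cauchy.
\<close>

lemma limit_of_molecules:
  assumes complete: "mcomplete" and u: "u \<in> FS"
    and near: "\<And>e. e > 0 \<Longrightarrow> \<exists>x\<in>M. \<exists>y\<in>M. x \<noteq> y \<and> (\<forall>f\<in>lip1 M d. \<bar>u f - mol x y f\<bar> \<le> e)"
  shows "\<exists>x\<in>M. \<exists>y\<in>M. x \<noteq> y \<and> u = mol x y"
proof -
  \<comment> \<open>two errors add up to at most 1/4, which keeps all distances within a factor 2 of the first\<close>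
  define e where "e n = 1 / (8 * (real n + 1))" for n
  have e: "0 < e n" "e n \<le> 1/8" for n by (auto simp: e_def divide_simps)
  have "\<forall>n. \<exists>p. fst p \<in> M \<and> snd p \<in> M \<and> fst p \<noteq> snd p \<and>
      (\<forall>f\<in>lip1 M d. \<bar>u f - mol (fst p) (snd p) f\<bar> \<le> e n)"
    using near[OF e(1)] by fastforce
  then obtain P where P: "\<forall>n. fst (P n) \<in> M \<and> snd (P n) \<in> M \<and> fst (P n) \<noteq> snd (P n) \<and>
      (\<forall>f\<in>lip1 M d. \<bar>u f - mol (fst (P n)) (snd (P n)) f\<bar> \<le> e n)"
    by metis
  define X Y where "X n = fst (P n)" and "Y n = snd (P n)" for n
  have XY: "X n \<in> M" "Y n \<in> M" "X n \<noteq> Y n" for n using P by (auto simp: X_def Y_def)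
  have u_near: "\<bar>u f - mol (X n) (Y n) f\<bar> \<le> e n" if "f \<in> lip1 M d" for n f
    using P that by (auto simp: X_def Y_def)
  have pair: "\<bar>mol (X n) (Y n) f - mol (X k) (Y k) f\<bar> \<le> e n + e k" if "f \<in> lip1 M d" for n k f
    using u_near[OF that, of n] u_near[OF that, of k] by (smt (verit))
  have close: "d (X n) (X k) \<le> (e n + e k) * d (X n) (Y n)"
    "d (Y n) (Y k) \<le> (e n + e k) * d (X n) (Y n)" for n k
  proof -
    have "e n + e k < 1" using e(2)[of n] e(2)[of k] by linarith
    note * = molecules_near_both_endpoints[OF XY[of n] XY[of k] this pair]
    show "d (X n) (X k) \<le> (e n + e k) * d (X n) (Y n)" by (rule *(1))
    show "d (Y n) (Y k) \<le> (e n + e k) * d (X n) (Y n)" by (rule *(2))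
  qed
  define D where "D = d (X 0) (Y 0)"
  have D: "D > 0" using XY[of 0] by (simp add: D_def)
  have range: "D / 2 \<le> d (X n) (Y n)" "d (X n) (Y n) \<le> 2 * D" for n
  proof -
    have "(e 0 + e n) * D \<le> 1/4 * D"
      using e(2)[of 0] e(2)[of n] D by (intro mult_right_mono) auto
    then have c: "d (X 0) (X n) \<le> D / 4" "d (Y 0) (Y n) \<le> D / 4"
      using close[of 0 n] by (auto simp: D_def)
    have "d (X n) (Y n) \<le> d (X n) (X 0) + d (X 0) (Y 0) + d (Y 0) (Y n)"
      using triangle[OF XY(1)[of n] XY(1)[of 0] XY(2)[of n]]
        triangle[OF XY(1)[of 0] XY(2)[of 0] XY(2)[of n]] by linarith
    then show "d (X n) (Y n) \<le> 2 * D" using c D commute[of "X n" "X 0"] by (simp add: D_def)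
    have "d (X 0) (Y 0) \<le> d (X 0) (X n) + d (X n) (Y n) + d (Y n) (Y 0)"
      using triangle[OF XY(1)[of 0] XY(1)[of n] XY(2)[of 0]]
        triangle[OF XY(1)[of n] XY(2)[of n] XY(2)[of 0]] by linarith
    then show "D / 2 \<le> d (X n) (Y n)" using c D commute[of "Y n" "Y 0"] by (simp add: D_def)
  qed
  have e_sum: "(e n + e k) * d (X n) (Y n) \<le> D * inverse (real (Suc N))" if "N \<le> n" "N \<le> k" for n k N
  proof -
    have le: "e m \<le> inverse (real (Suc N)) / 8" if "N \<le> m" for m
      using that by (simp add: e_def field_simps)
    have "(e n + e k) * d (X n) (Y n) \<le> (inverse (real (Suc N)) / 4) * (2 * D)"
      using le[OF that(1)] le[OF that(2)] range(2)[of n] e(1)[of n] e(1)[of k]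
      by (intro mult_mono) auto
    also have "\<dots> \<le> D * inverse (real (Suc N))" using D by simp
    finally show ?thesis .
  qed
  have cauchy: "MCauchy Z"
    if Z: "\<And>n. Z n \<in> M" "\<And>n k. d (Z n) (Z k) \<le> (e n + e k) * d (X n) (Y n)" for Z
    unfolding MCauchy_def
  proof (intro conjI allI impI)
    show "range Z \<subseteq> M" using Z(1) by blast
    fix \<epsilon> :: real assume "\<epsilon> > 0"
    then obtain N where N: "inverse (real (Suc N)) < \<epsilon> / D"
      using D reals_Archimedean[of "\<epsilon> / D"] by auto
    then have N': "D * inverse (real (Suc N)) < \<epsilon>" using D by (simp add: field_simps)
    have "d (Z n) (Z k) < \<epsilon>" if "N \<le> n" "N \<le> k" for n k
      using Z(2)[of n k] e_sum[OF that] N' by linarith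
    then show "\<exists>N. \<forall>n n'. N \<le> n \<longrightarrow> N \<le> n' \<longrightarrow> d (Z n) (Z n') < \<epsilon>" by blast
  qed
  have conv: "\<exists>z\<in>M. (\<lambda>n. d (Z n) z) \<longlonglongrightarrow> 0" if "MCauchy Z" for Z
    using complete that unfolding mcomplete_def limitin_metric_dist_null by blast
  obtain x y where x: "x \<in> M" "(\<lambda>n. d (X n) x) \<longlonglongrightarrow> 0" and y: "y \<in> M" "(\<lambda>n. d (Y n) y) \<longlonglongrightarrow> 0"
    using conv[OF cauchy[OF XY(1) close(1)]] conv[OF cauchy[OF XY(2) close(2)]] by blast
  have f_lim: "(\<lambda>n. f (Z n)) \<longlonglongrightarrow> f z"
    if f: "f \<in> lip1 M d" and Z: "\<And>n. Z n \<in> M" "z \<in> M" "(\<lambda>n. d (Z n) z) \<longlonglongrightarrow> 0" for f Z z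
  proof -
    have "norm (f (Z n) - f z) \<le> d (Z n) z" for n using f Z(1)[of n] Z(2) by (simp add: lip1_def)
    then have "(\<lambda>n. f (Z n) - f z) \<longlonglongrightarrow> 0" by (intro Lim_null_comparison[OF _ Z(3)] always_eventually) auto
    then show ?thesis using LIM_zero_iff by blast
  qed
  have d_lim: "(\<lambda>n. d (X n) (Y n)) \<longlonglongrightarrow> d x y"
  proof -
    have "norm (d (X n) (Y n) - d x y) \<le> d (X n) x + d (Y n) y" for n
    proof -
      have "d (X n) (Y n) \<le> d (X n) x + d x y + d y (Y n)"
        using triangle[OF XY(1)[of n] x(1) XY(2)[of n]] triangle[OF x(1) y(1) XY(2)[of n]] by linarith
      moreover have "d x y \<le> d x (X n) + d (X n) (Y n) + d (Y n) y"
        using triangle[OF x(1) XY(1)[of n] y(1)] triangle[OF XY(1)[of n] XY(2)[of n] y(1)] by linarith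
      ultimately show ?thesis
        unfolding real_norm_def abs_le_iff commute[of x "X n"] commute[of y "Y n"] by simp
    qed
    moreover have "(\<lambda>n. d (X n) x + d (Y n) y) \<longlonglongrightarrow> 0" using tendsto_add[OF x(2) y(2)] by simp
    ultimately have "(\<lambda>n. d (X n) (Y n) - d x y) \<longlonglongrightarrow> 0"
      by (rule Lim_null_comparison[OF always_eventually[OF allI]])
    then show ?thesis using LIM_zero_iff by blast
  qed
  have "D / 2 \<le> d x y"
    by (rule LIMSEQ_le_const[OF d_lim]) (use range(1) in blast)
  then have dxy: "d x y > 0" using D by linarith
  then have ne: "x \<noteq> y" using x(1) by auto
  have e_lim: "e \<longlonglongrightarrow> 0"
  proof -
    have "(\<lambda>n. 1/8 * inverse (real (Suc n))) \<longlonglongrightarrow> 1/8 * 0"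
      by (intro tendsto_mult tendsto_const LIMSEQ_inverse_real_of_nat)
    moreover have eq: "(\<lambda>n. 1/8 * inverse (real (Suc n))) = e" by (auto simp: e_def fun_eq_iff field_simps)
    ultimately show ?thesis unfolding eq by simp
  qed
  have "u = mol x y"
  proof
    fix f
    show "u f = mol x y f"
    proof (cases "f \<in> lip1 M d")
      case True
      have "(\<lambda>n. mol (X n) (Y n) f - u f) \<longlonglongrightarrow> 0"
      proof (rule Lim_null_comparison[OF _ e_lim])
        show "\<forall>\<^sub>F n in sequentially. norm (mol (X n) (Y n) f - u f) \<le> e n"
          using u_near[OF True] by (intro always_eventually) (simp add: abs_minus_commute)
      qed
      then have 1: "(\<lambda>n. mol (X n) (Y n) f) \<longlonglongrightarrow> u f" using LIM_zero_iff by blast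
      have "(\<lambda>n. (f (X n) - f (Y n)) / d (X n) (Y n)) \<longlonglongrightarrow> (f x - f y) / d x y"
        using dxy by (intro tendsto_divide tendsto_diff f_lim True XY x y d_lim) auto
      then have "(\<lambda>n. mol (X n) (Y n) f) \<longlonglongrightarrow> mol x y f"
        using True XY x(1) y(1) by (simp add: molecule_apply)
      with 1 show ?thesis by (rule LIMSEQ_unique)
    next
      case False
      then show ?thesis
        using free_space_outside[OF u] free_space_outside[OF molecule_in[OF x(1) y(1)]] by simp
    qed
  qed
  with x(1) y(1) ne show ?thesis by blast
qed

lemma surj_lin_isometry_inv:
  assumes T: "surj_lin_isometry FS FN T"
  shows "bij_betw T FS FS" "surj_lin_isometry FS FN (inv_into FS T)"
proof -
  have lin: "linear_on FS T" and iso: "\<And>u. u \<in> FS \<Longrightarrow> FN (T u) = FN u" and im: "T ` FS = FS"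
    using T by (auto simp: surj_lin_isometry_def)
  note sF = subspace_free_space[of M d]
  have "inj_on T FS"
  proof (rule inj_onI)
    fix u v assume uv: "u \<in> FS" "v \<in> FS" "T u = T v"
    have D: "u - v \<in> FS" by (rule subspace_diff[OF sF uv(1,2)])
    have "T (u - v) = 0" using linear_on_diff[OF lin sF uv(1,2)] uv(3) by simp
    then have "FN (u - v) = 0" using iso[OF D] free_norm_0 by simp
    then show "u = v" using free_norm_eq_0[OF D] by simp
  qed
  then show bij: "bij_betw T FS FS" using im by (simp add: bij_betw_def)
  let ?R = "inv_into FS T"
  have RT: "?R (T u) = u" if "u \<in> FS" for u using bij_betw_inv_into_left[OF bij that] .
  have TR: "T (?R u) = u" if "u \<in> FS" for u using bij_betw_inv_into_right[OF bij that] .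
  have bijR: "bij_betw ?R FS FS" by (rule bij_betw_inv_into[OF bij])
  have R_in: "?R u \<in> FS" if "u \<in> FS" for u using bij_betwE[OF bijR] that by blast
  have "linear_on FS ?R"
    unfolding linear_on_def
  proof (intro conjI ballI allI)
    fix u v assume uv: "u \<in> FS" "v \<in> FS"
    have "T (?R u + ?R v) = u + v"
      using linear_onD(1)[OF lin R_in[OF uv(1)] R_in[OF uv(2)]] TR uv by simp
    then show "?R (u + v) = ?R u + ?R v"
      using RT[OF subspace_add[OF sF R_in[OF uv(1)] R_in[OF uv(2)]]] by simp
  next
    fix c u assume u: "u \<in> FS"
    have "T (c *\<^sub>R ?R u) = c *\<^sub>R u"
      unfolding linear_onD(2)[OF lin R_in[OF u]] TR[OF u] ..
    then show "?R (c *\<^sub>R u) = c *\<^sub>R ?R u"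
      using RT[OF subspace_scale[OF sF R_in[OF u]], of c] by argo
  qed
  moreover have "FN (?R u) = FN u" if "u \<in> FS" for u
    using iso[OF R_in[OF that]] TR[OF that] by simp
  ultimately show "surj_lin_isometry FS FN ?R"
    using bijR by (simp add: surj_lin_isometry_def bij_betw_def)
qed

text \<open>
  Transporting a slice by \<open>T\<close> gives a slice at \<open>T (mol x y)\<close>, cut out by a Lipschitz function \<open>k\<close>.  It
  contains a molecule, for otherwise \<open>k\<close> would have a Lipschitz constant too small for its value at
  \<open>T (mol x y)\<close>; the preimage of that molecule lies in the original slice.
\<close>

lemma isometry_image_of_concave_molecule:
  assumes complete: mcomplete and T: "surj_lin_isometry FS FN T" and cp: "concave_pair M d x y"
  shows "\<exists>a\<in>M. \<exists>b\<in>M. a \<noteq> b \<and> T (mol x y) = mol a b"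
proof -
  have M: "x \<in> M" "y \<in> M" "x \<noteq> y" using cp by (auto simp: concave_pair_def)
  let ?m = "mol x y" and ?R = "inv_into FS T"
  have m: "?m \<in> FS" by (rule molecule_in[OF M(1,2)])
  have lin: "linear_on FS T" and iso: "\<And>u. u \<in> FS \<Longrightarrow> FN (T u) = FN u" and T_in: "\<And>u. u \<in> FS \<Longrightarrow> T u \<in> FS"
    using T by (auto simp: surj_lin_isometry_def)
  note bij = surj_lin_isometry_inv(1)[OF T]
  have linR: "linear_on FS ?R" and isoR: "\<And>u. u \<in> FS \<Longrightarrow> FN (?R u) = FN u"
    and R_in: "\<And>u. u \<in> FS \<Longrightarrow> ?R u \<in> FS"
    using surj_lin_isometry_inv(2)[OF T] by (auto simp: surj_lin_isometry_def)
  have RT: "?R (T u) = u" if "u \<in> FS" for u using bij_betw_inv_into_left[OF bij that] .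
  have TR: "T (?R u) = u" if "u \<in> FS" for u using bij_betw_inv_into_right[OF bij that] .
  show ?thesis
  proof (rule limit_of_molecules[OF complete T_in[OF m]])
    fix e :: real assume e: "e > 0"
    obtain h \<beta> where h: "h \<in> lip1 M d" and \<beta>: "\<beta> > 0" "\<beta> \<le> 1/4" "(h x - h y) / d x y \<ge> 1 - \<beta>"
      and slice: "\<And>\<Phi>. lip_functional M d \<Phi> \<Longrightarrow> \<Phi> h \<ge> 1 - 2 * \<beta> \<Longrightarrow>
        \<forall>f\<in>lip1 M d. \<bar>\<Phi> f - (f x - f y) / d x y\<bar> \<le> e"
      using concave_pair_slice[OF cp, of 2 e] e by auto
    have "linear_on FS (\<lambda>u. ?R u h)"
      using linR by (simp add: linear_on_def)
    moreover have "\<bar>?R u h\<bar> \<le> 1 * FN u" if "u \<in> FS" for u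
      using abs_le_free_norm[OF R_in[OF that] h] isoR[OF that] by simp
    ultimately obtain k where k: "k \<in> lip1 M d" "\<forall>u\<in>FS. ?R u h = 1 * u k"
      using dual_eq_eval_at[of "\<lambda>u. ?R u h" 1, OF _ _ _ M(1)] by auto
    have "\<exists>a\<in>M. \<exists>b\<in>M. a \<noteq> b \<and> 1 - 2 * \<beta> \<le> mol a b k"
    proof (rule ccontr)
      assume no: "\<not> ?thesis"
      let ?c = "1 - 2 * \<beta>"
      have c: "?c > 0" using \<beta> by simp
      have slope: "k a - k b \<le> ?c * d a b" if ab: "a \<in> M" "b \<in> M" for a b
      proof (cases "a = b")
        case False
        then have "mol a b k \<le> ?c" using no ab by force
        then show ?thesis
          using k(1) ab False by (simp add: molecule_apply divide_le_eq)
      qed (use ab in simp)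
      define k' where "k' z = (1 / ?c) * k z + 0 * k z" for z
      have k': "k' \<in> lip1 M d"
      proof (rule lip1I[OF _ commute])
        fix a b assume ab: "a \<in> M" "b \<in> M"
        have "k' a - k' b = (k a - k b) / ?c" by (simp add: k'_def diff_divide_distrib)
        also have "\<dots> \<le> d a b" using slope[OF ab] c by (simp add: pos_divide_le_eq mult.commute)
        finally show "k' a - k' b \<le> d a b" .
      qed
      have "T ?m k' = (1 / ?c) * T ?m k + 0 * T ?m k"
        unfolding k'_def
        by (rule free_space_combination[OF T_in[OF m] k(1) k(1) k'[unfolded k'_def]])
      moreover have "\<bar>T ?m k'\<bar> \<le> 1"
        using abs_le_free_norm[OF T_in[OF m] k'] iso[OF m] free_norm_molecule[OF M] by simp
      ultimately have "T ?m k / ?c \<le> 1" using c by (simp add: abs_le_iff)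
      then have "T ?m k \<le> ?c" using c by (simp add: divide_le_eq)
      moreover have "T ?m k = ?m h" using bspec[OF k(2) T_in[OF m]] RT[OF m] by simp
      moreover have "?m h \<ge> 1 - \<beta>" using \<beta>(3) h M by (simp add: molecule_apply)
      ultimately show False using \<beta> by linarith
    qed
    then obtain a b where ab: "a \<in> M" "b \<in> M" "a \<noteq> b" "1 - 2 * \<beta> \<le> mol a b k" by blast
    let ?n = "mol a b"
    have n: "?n \<in> FS" by (rule molecule_in[OF ab(1,2)])
    have "?R ?n h \<ge> 1 - 2 * \<beta>" using k(2) n ab(4) by simp
    moreover have "lip_functional M d (?R ?n)"
      using lip_functional_free_space[OF R_in[OF n]] isoR[OF n] free_norm_molecule[OF ab(1-3)] by simp
    ultimately have sl: "\<bar>?R ?n f - ?m f\<bar> \<le> e" if "f \<in> lip1 M d" for f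
      using slice that M by (simp add: molecule_apply)
    have D: "?R ?n - ?m \<in> FS" by (rule subspace_diff[OF subspace_free_space R_in[OF n] m])
    have "FN (?R ?n - ?m) \<le> e" unfolding free_norm_le[OF D] using sl by simp
    moreover have "T (?R ?n - ?m) = ?n - T ?m"
      unfolding linear_on_diff[OF lin subspace_free_space R_in[OF n] m] TR[OF n] ..
    ultimately have N: "FN (?n - T ?m) \<le> e" using iso[OF D] by simp
    have D': "?n - T ?m \<in> FS" by (rule subspace_diff[OF subspace_free_space n T_in[OF m]])
    have "\<bar>T ?m f - ?n f\<bar> \<le> e" if "f \<in> lip1 M d" for f
      using N that unfolding free_norm_le[OF D'] by (simp add: abs_minus_commute)
    with ab show "\<exists>a\<in>M. \<exists>b\<in>M. a \<noteq> b \<and> (\<forall>f\<in>lip1 M d. \<bar>T ?m f - mol a b f\<bar> \<le> e)" by blast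
  qed
qed

text \<open>
  A tent at a point of the support that is narrow enough to miss the rest of it reads off the value there.
\<close>

lemma free_embed_inj: "inj_on (free_embed M d) (pre_free M)"
proof (rule inj_onI)
  fix u v assume uv: "u \<in> pre_free M" "v \<in> pre_free M" "free_embed M d u = free_embed M d v"
  define w where "w = u - v"
  have w: "w \<in> pre_free M" unfolding w_def by (rule subspace_diff[OF subspace_pre_free uv(1,2)])
  have w0: "pairing w f = 0" if "f \<in> lip1 M d" for f
  proof -
    have "free_embed M d w f = 0"
      unfolding w_def linear_on_diff[OF free_embed_linear subspace_pre_free uv(1,2)] using uv(3) by simp
    then show ?thesis using that by (simp add: free_embed_def)
  qed
  have "w p = 0" for p
  proof (rule ccontr)
    assume p: "w p \<noteq> 0"
    let ?A = "{m. w m \<noteq> 0}"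
    have A: "finite ?A" "?A \<subseteq> M" using pre_freeD(1,2)[OF w] by auto
    define r where "r = Min (insert 1 ((\<lambda>m. d m p) ` (?A - {p})))"
    have "d m p > 0" if "m \<in> ?A - {p}" for m
      using that A(2) p by (intro mdist_pos_less) auto
    then have r: "r > 0" unfolding r_def using A(1) by (subst Min_gr_iff) auto
    have far: "r \<le> d m p" if "w m \<noteq> 0" "m \<noteq> p" for m
      unfolding r_def using A that by (intro Min_le) auto
    define f where "f m = max 0 (r - d m p)" for m
    have f: "f \<in> lip1 M d"
    proof (rule lip1I[OF _ commute])
      fix u v assume "u \<in> M" "v \<in> M"
      then have "d v p \<le> d v u + d u p" using A p by (intro triangle) auto
      with nonneg[of u v] show "f u - f v \<le> d u v"
        unfolding f_def commute[of v u] by linarith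
    qed
    have "pairing w f = (\<Sum>m\<in>{p}. w m * f m)"
      unfolding pairing_def using A p far by (intro sum.mono_neutral_right) (auto simp: f_def)
    moreover have "f p = r" using A p r by (auto simp: f_def)
    ultimately show False using w0[OF f] p r by simp
  qed
  then have "w = 0" by (simp add: fun_eq_iff)
  then show "u = v" by (simp add: w_def)
qed

lemma embed_point_diff_eq:
  assumes "x \<in> M" "y \<in> M" "x \<noteq> y"
  shows "free_embed M d (point_diff x y) = d x y *\<^sub>R mol x y"
  using assms by (simp add: molecule_eq)

lemma isometry_edge:
  assumes complete: mcomplete and T: "surj_lin_isometry FS FN T" and cp: "concave_pair M d x y"
  shows "\<exists>a\<in>M. \<exists>b\<in>M. \<exists>c. T (free_embed M d (point_diff x y)) = c *\<^sub>R free_embed M d (point_diff a b)"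
proof -
  have M: "x \<in> M" "y \<in> M" "x \<noteq> y" using cp by (auto simp: concave_pair_def)
  have lin: "linear_on FS T" using T by (simp add: surj_lin_isometry_def)
  obtain a b where ab: "a \<in> M" "b \<in> M" "T (mol x y) = mol a b"
    using isometry_image_of_concave_molecule[OF assms] by blast
  have "T (free_embed M d (point_diff x y)) = d x y *\<^sub>R mol a b"
    unfolding embed_point_diff_eq[OF M] linear_onD(2)[OF lin molecule_in[OF M(1,2)]] ab(3) ..
  also have "\<dots> = (d x y * (1 / d a b)) *\<^sub>R free_embed M d (point_diff a b)"
    unfolding molecule_eq[OF ab(1,2)] scaleR_scaleR ..
  finally show ?thesis using ab(1,2) by blast
qed

text \<open>
  Edges span the finitely supported elements, and they go to multiples of differences.
\<close>

lemma isometry_preserves_pre_free: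
  assumes conn: "graph_connected M E" and edges: "E \<subseteq> {(x, y). concave_pair M d x y}"
    and complete: mcomplete and T: "surj_lin_isometry FS FN T" and p: "p \<in> pre_free M"
  shows "T (free_embed M d p) \<in> free_embed M d ` pre_free M"
proof -
  let ?e = "free_embed M d" and ?P = "pre_free M"
  have lin: "linear_on FS T" using T by (simp add: surj_lin_isometry_def)
  note em = free_embed_linear[of M d] and sP = subspace_pre_free[of M]
  have linTe: "linear_on ?P (\<lambda>p. T (?e p))"
    unfolding linear_on_def
    by (simp add: linear_onD(1)[OF em] linear_onD(2)[OF em] linear_onD(1)[OF lin] linear_onD(2)[OF lin]
        free_embed_in)
  have "subspace (?e ` ?P)"
  proof (rule subspaceI)
    have "?e 0 \<in> ?e ` ?P" by (rule imageI[OF subspace_0[OF sP]])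
    then show "0 \<in> ?e ` ?P" unfolding linear_on_0[OF em sP] .
  next
    fix a b assume "a \<in> ?e ` ?P" "b \<in> ?e ` ?P"
    then obtain a' b' where ab: "a = ?e a'" "b = ?e b'" "a' \<in> ?P" "b' \<in> ?P" by blast
    show "a + b \<in> ?e ` ?P"
      unfolding ab linear_onD(1)[OF em ab(3,4), symmetric] by (rule imageI[OF subspace_add[OF sP ab(3,4)]])
  next
    fix c a assume "a \<in> ?e ` ?P"
    then obtain a' where a: "a = ?e a'" "a' \<in> ?P" by blast
    show "c *\<^sub>R a \<in> ?e ` ?P"
      unfolding a linear_onD(2)[OF em a(2), symmetric] by (rule imageI[OF subspace_scale[OF sP a(2)]])
  qed
  then have "subspace {p \<in> ?P. T (?e p) \<in> ?e ` ?P}"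
    by (rule linear_image_subspace[OF linTe sP])
  moreover have "edge_diffs M E \<subseteq> {p \<in> ?P. T (?e p) \<in> ?e ` ?P}"
  proof
    fix q assume q: "q \<in> edge_diffs M E"
    then obtain x y where xy: "q = point_diff x y" "concave_pair M d x y" "x \<in> M" "y \<in> M"
      using edges unfolding edge_diffs_def by blast
    then obtain a b c where ab: "a \<in> M" "b \<in> M" "T (?e q) = c *\<^sub>R ?e (point_diff a b)"
      using isometry_edge[OF complete T xy(2)] by blast
    then have "T (?e q) = ?e (c *\<^sub>R point_diff a b)"
      using linear_onD(2)[OF em point_diff_in_pre_free[OF ab(1,2)]] by simp
    then have "T (?e q) \<in> ?e ` ?P"
      using subspace_scale[OF sP point_diff_in_pre_free[OF ab(1,2)]] by blast
    then show "q \<in> {p \<in> ?P. T (?e p) \<in> ?e ` ?P}" using xy by (simp add: point_diff_in_pre_free)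
  qed
  ultimately show ?thesis
    using p span_minimal[of "edge_diffs M E"] unfolding pre_free_eq_span[OF conn] by blast
qed

end

section \<open>Rigidity and the Prague property\<close>

context Metric_space
begin

lemma isometry_vertex_relabelling:
  assumes complete: mcomplete and E: "simple_graph M E" and conn: "n_connected 3 M E"
    and edges: "E \<subseteq> {(x, y). concave_pair M d x y}"
    and T: "surj_lin_isometry FS FN T"
    and three: "\<And>a b. \<exists>z\<in>M. z \<noteq> a \<and> z \<noteq> b"
  shows "\<exists>g \<kappa>. \<kappa> \<noteq> 0 \<and> bij_betw g M M \<and>
    (\<forall>x\<in>M. \<forall>y\<in>M. T (free_embed M d (point_diff x y)) = \<kappa> *\<^sub>R free_embed M d (point_diff (g x) (g y)))"
proof -
  let ?e = "free_embed M d" and ?P = "pre_free M" and ?R = "inv_into FS T"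
  note em = free_embed_linear[of M d] and sP = subspace_pre_free[of M]
  have lin: "linear_on FS T" using T by (simp add: surj_lin_isometry_def)
  note bij = surj_lin_isometry_inv(1)[OF T] and TR = surj_lin_isometry_inv(2)[OF T]
  have conn0: "graph_connected M E"
    using conn[unfolded n_connected_def, rule_format, of "{}"] by simp
  define S where "S p = inv_into ?P ?e (T (?e p))" for p
  have eS: "?e (S p) = T (?e p)" and S_in: "S p \<in> ?P" if "p \<in> ?P" for p
    using isometry_preserves_pre_free[OF conn0 edges complete T that]
    unfolding S_def by (rule f_inv_into_f, rule inv_into_into)
  have inj: "p = q" if "p \<in> ?P" "q \<in> ?P" "?e p = ?e q" for p q
    using free_embed_inj that by (auto dest: inj_onD)
  have S: "linear_on ?P S"
    unfolding linear_on_def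
  proof (intro conjI ballI allI)
    fix p q assume pq: "p \<in> ?P" "q \<in> ?P"
    show "S (p + q) = S p + S q"
    proof (rule inj)
      show "?e (S (p + q)) = ?e (S p + S q)"
        unfolding eS[OF subspace_add[OF sP pq]] linear_onD(1)[OF em pq]
          linear_onD(1)[OF em S_in[OF pq(1)] S_in[OF pq(2)]] eS[OF pq(1)] eS[OF pq(2)]
        by (rule linear_onD(1)[OF lin free_embed_in[OF pq(1)] free_embed_in[OF pq(2)]])
    qed (intro S_in subspace_add[OF sP] pq)+
  next
    fix c p assume p: "p \<in> ?P"
    show "S (c *\<^sub>R p) = c *\<^sub>R S p"
    proof (rule inj)
      show "?e (S (c *\<^sub>R p)) = ?e (c *\<^sub>R S p)"
        unfolding eS[OF subspace_scale[OF sP p]] linear_onD(2)[OF em p]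
          linear_onD(2)[OF em S_in[OF p]] eS[OF p]
        by (rule linear_onD(2)[OF lin free_embed_in[OF p]])
    qed (intro S_in subspace_scale[OF sP] p)+
  qed
  have "bij_betw S ?P ?P"
    unfolding bij_betw_def
  proof (intro conjI inj_onI equalityI subsetI)
    fix p q assume pq: "p \<in> ?P" "q \<in> ?P" "S p = S q"
    then have "T (?e p) = T (?e q)" using eS by metis
    then have "?e p = ?e q"
      using bij free_embed_in[OF pq(1)] free_embed_in[OF pq(2)] by (auto simp: bij_betw_def dest: inj_onD)
    then show "p = q" by (rule inj[OF pq(1,2)])
  next
    fix q assume q: "q \<in> ?P"
    obtain p where p: "p \<in> ?P" "?R (?e q) = ?e p"
      using isometry_preserves_pre_free[OF conn0 edges complete TR q] by blast
    have "T (?e p) = ?e q"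
      unfolding p(2)[symmetric] by (rule bij_betw_inv_into_right[OF bij free_embed_in[OF q]])
    then have "S p = q" using inj[OF S_in[OF p(1)] q] eS[OF p(1)] by simp
    then show "q \<in> S ` ?P" using p(1) by blast
  qed (use S_in in blast)
  moreover have "\<exists>a\<in>M. \<exists>b\<in>M. \<exists>c. S (point_diff x y) = c *\<^sub>R point_diff a b" if "(x, y) \<in> E" for x y
  proof -
    have cp: "concave_pair M d x y" using edges that by blast
    then have xy: "point_diff x y \<in> ?P"
      by (intro point_diff_in_pre_free) (auto simp: concave_pair_def)
    obtain a b c where ab: "a \<in> M" "b \<in> M" "T (?e (point_diff x y)) = c *\<^sub>R ?e (point_diff a b)"
      using isometry_edge[OF complete T cp] by blast
    note pab = point_diff_in_pre_free[OF ab(1,2)]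
    have "S (point_diff x y) = c *\<^sub>R point_diff a b"
      by (rule inj[OF S_in[OF xy] subspace_scale[OF sP pab]])
        (simp only: eS[OF xy] linear_onD(2)[OF em pab] ab(3))
    then show ?thesis using ab(1,2) by blast
  qed
  ultimately obtain g \<kappa> where g: "\<kappa> \<noteq> 0" "bij_betw g M M"
      "\<And>x y. x \<in> M \<Longrightarrow> y \<in> M \<Longrightarrow> S (point_diff x y) = \<kappa> *\<^sub>R point_diff (g x) (g y)"
    using vertex_relabelling[OF E conn S _ _ three] by metis
  have "T (?e (point_diff x y)) = \<kappa> *\<^sub>R ?e (point_diff (g x) (g y))" if xy: "x \<in> M" "y \<in> M" for x y
  proof -
    have "g x \<in> M" "g y \<in> M" using g(2) xy by (auto dest: bij_betwE)
    note pg = point_diff_in_pre_free[OF this]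
    show ?thesis
      unfolding eS[OF point_diff_in_pre_free[OF xy], symmetric] g(3)[OF xy] by (rule linear_onD(2)[OF em pg])
  qed
  with g(1,2) show ?thesis by blast
qed

lemma free_norm_scaleR:
  assumes u: "u \<in> FS"
  shows "FN (c *\<^sub>R u) = \<bar>c\<bar> * FN u"
proof -
  have le: "FN (c *\<^sub>R v) \<le> \<bar>c\<bar> * FN v" if v: "v \<in> FS" for c v
    unfolding free_norm_le[OF subspace_scale[OF subspace_free_space v]]
    using abs_le_free_norm[OF v] by (simp add: abs_mult mult_left_mono)
  show ?thesis
  proof (cases "c = 0")
    case False
    have "FN ((1 / c) *\<^sub>R (c *\<^sub>R u)) \<le> \<bar>1 / c\<bar> * FN (c *\<^sub>R u)"
      by (rule le[OF subspace_scale[OF subspace_free_space u]])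
    moreover have "(1 / c) *\<^sub>R (c *\<^sub>R u) = u" using False by (simp only: scaleR_scaleR) simp
    ultimately have "\<bar>c\<bar> * FN u \<le> FN (c *\<^sub>R u)" using False by (simp add: field_simps)
    then show ?thesis using le[OF u, of c] by simp
  qed (simp only: scaleR_zero_left free_norm_0 abs_zero mult_zero_left)
qed

text \<open>
  The relabelling \<open>g\<close> comes with one factor \<open>\<kappa>\<close> for all pairs; comparing norms of molecules makes
  \<open>g\<close> a \<open>\<bar>\<kappa>\<bar>\<close>-dilation, and \<open>sgn \<kappa>\<close> is the sign.  A space with two points has to be treated apart: its free
  space is a line, on which \<open>T\<close> is \<open>1\<close> or \<open>-1\<close>, and the identity serves as \<open>g\<close>.
\<close>

lemma rigid_of_3_connected_concave_graph:
  assumes complete: mcomplete and E: "simple_graph M E" and conn: "n_connected 3 M E"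
    and edges: "E \<subseteq> {(x, y). concave_pair M d x y}"
    and two: "\<exists>x\<in>M. \<exists>y\<in>M. x \<noteq> y"
  shows "lipschitz_free_rigid M d"
  unfolding lipschitz_free_rigid_def
proof (intro allI impI)
  fix T assume T: "surj_lin_isometry FS FN T"
  have lin: "linear_on FS T" and iso: "\<And>u. u \<in> FS \<Longrightarrow> FN (T u) = FN u"
    using T by (auto simp: surj_lin_isometry_def)
  let ?goal = "\<exists>\<epsilon>\<in>{1, -1}. \<exists>a g. dilation M d a g \<and> g ` M = M \<and>
    (\<forall>x\<in>M. \<forall>y\<in>M. x \<noteq> y \<longrightarrow> T (mol x y) = \<epsilon> *\<^sub>R mol (g x) (g y))"
  show ?goal
  proof (cases "\<forall>a b. \<exists>z\<in>M. z \<noteq> a \<and> z \<noteq> b")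
    case True
    then obtain g \<kappa> where k: "\<kappa> \<noteq> 0" and g: "bij_betw g M M"
      and Tg: "\<And>x y. x \<in> M \<Longrightarrow> y \<in> M \<Longrightarrow>
        T (free_embed M d (point_diff x y)) = \<kappa> *\<^sub>R free_embed M d (point_diff (g x) (g y))"
      using isometry_vertex_relabelling[OF complete E conn edges T] by metis
    have gM: "g x \<in> M" if "x \<in> M" for x using g that by (auto dest: bij_betwE)
    have g_ne: "g x \<noteq> g y" if "x \<in> M" "y \<in> M" "x \<noteq> y" for x y
      using g that by (auto simp: bij_betw_def dest: inj_onD)
    have Tm: "T (mol x y) = (\<kappa> * d (g x) (g y) / d x y) *\<^sub>R mol (g x) (g y)"
      if xy: "x \<in> M" "y \<in> M" "x \<noteq> y" for x y
    proof -
      have "T (mol x y) = (1 / d x y) *\<^sub>R T (free_embed M d (point_diff x y))"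
        unfolding molecule_eq[OF xy(1,2)]
        by (rule linear_onD(2)[OF lin free_embed_in[OF point_diff_in_pre_free[OF xy(1,2)]]])
      then show ?thesis
        unfolding Tg[OF xy(1,2)] embed_point_diff_eq[OF gM[OF xy(1)] gM[OF xy(2)] g_ne[OF xy]] scaleR_scaleR
        by (simp add: mult_ac)
    qed
    have dist: "d x y = \<bar>\<kappa>\<bar> * d (g x) (g y)" if xy: "x \<in> M" "y \<in> M" for x y
    proof (cases "x = y")
      case False
      let ?n = "mol (g x) (g y)" and ?c = "\<kappa> * d (g x) (g y) / d x y"
      have n: "?n \<in> FS" "FN ?n = 1"
        using molecule_in free_norm_molecule gM xy g_ne False by auto
      have N: "FN (?c *\<^sub>R ?n) = 1"
        using iso[OF molecule_in[OF xy]] free_norm_molecule[OF xy False] Tm[OF xy False] by simp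
      have "\<bar>?c\<bar> = 1" using N unfolding free_norm_scaleR[OF n(1)] n(2) by (simp only: mult_1_right)
      moreover have "g x \<noteq> g y" by (rule g_ne[OF xy False])
      ultimately show ?thesis using k xy gM False by (simp add: abs_mult abs_divide)
    qed (use xy gM in simp)
    have "dilation M d \<bar>\<kappa>\<bar> g" using k gM dist by (auto simp: dilation_def)
    moreover have "g ` M = M" using g by (simp add: bij_betw_def)
    moreover have "T (mol x y) = sgn \<kappa> *\<^sub>R mol (g x) (g y)" if xy: "x \<in> M" "y \<in> M" "x \<noteq> y" for x y
    proof -
      have "d (g x) (g y) > 0" using xy gM g_ne by simp
      then have "\<kappa> * d (g x) (g y) / d x y = sgn \<kappa>"
        unfolding dist[OF xy(1,2)] using k by (simp add: sgn_real_def)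
      then show ?thesis using Tm[OF xy] by simp
    qed
    moreover have "sgn \<kappa> \<in> {1, -1}" using k by (simp add: sgn_real_def)
    ultimately show ?thesis by blast
  next
    case False
    then obtain p q where pq: "\<And>z. z \<in> M \<Longrightarrow> z = p \<or> z = q" by blast
    obtain x y where xy: "x \<in> M" "y \<in> M" "x \<noteq> y" using two by blast
    have M2: "z = x \<or> z = y" if "z \<in> M" for z using pq xy that by metis
    have "(x, y) \<in> (E \<inter> M \<times> M)\<^sup>*"
      using conn[unfolded n_connected_def, rule_format, of "{}"] xy by (simp add: graph_connected_def)
    then obtain z where "(x, z) \<in> E" using xy(3) by (auto elim: converse_rtranclE)
    moreover have "z = y" using calculation M2 E xy by (auto simp: simple_graph_def irrefl_def)
    ultimately have cp: "concave_pair M d x y" using edges by blast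
    obtain a b where ab: "a \<in> M" "b \<in> M" "a \<noteq> b" "T (mol x y) = mol a b"
      using isometry_image_of_concave_molecule[OF complete T cp] by blast
    have "T (mol x y) = mol x y \<or> T (mol x y) = - mol x y"
      using ab M2[of a] M2[of b] molecule_swap[OF xy(1,2)] by auto
    then obtain \<epsilon> where eps: "\<epsilon> \<in> {1, -1::real}" "T (mol x y) = \<epsilon> *\<^sub>R mol x y" by force
    have "T (mol y x) = \<epsilon> *\<^sub>R mol y x"
    proof -
      have "T (mol y x) = T ((-1) *\<^sub>R mol x y)" using molecule_swap[OF xy(1,2)] by simp
      also have "\<dots> = (-1) *\<^sub>R T (mol x y)" by (rule linear_onD(2)[OF lin molecule_in[OF xy(1,2)]])
      also have "\<dots> = \<epsilon> *\<^sub>R mol y x" unfolding eps(2) molecule_swap[OF xy(1,2)] by simp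
      finally show ?thesis .
    qed
    then have "\<forall>u\<in>M. \<forall>v\<in>M. u \<noteq> v \<longrightarrow> T (mol u v) = \<epsilon> *\<^sub>R mol (id u) (id v)"
      using M2 eps(2) by (metis id_apply)
    moreover have "dilation M d 1 id" by (simp add: dilation_def)
    ultimately show ?thesis using eps(1) by (intro bexI[of _ \<epsilon>] exI[of _ 1] exI[of _ id]) auto
  qed
qed

lemma dist_le_walk:
  assumes "\<And>i. i < k \<Longrightarrow> (p i, p (Suc i)) \<in> M \<times> M" "p 0 \<in> M"
  shows "d (p 0) (p k) \<le> (\<Sum>i<k. d (p i) (p (Suc i)))"
  using assms
proof (induction k)
  case (Suc k)
  have "p k \<in> M" "p (Suc k) \<in> M" using Suc.prems(1)[of k] by auto
  then have "d (p 0) (p (Suc k)) \<le> d (p 0) (p k) + d (p k) (p (Suc k))"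
    using Suc.prems(2) by (intro triangle)
  with Suc show ?case by simp
qed simp

text \<open>
  Walks along concave pairs are walks in \<open>E_ext\<close>; they connect all points, reach the infimum, and by the
  triangle inequality no walk is shorter.
\<close>

lemma prague_space_of_concave_walks:
  assumes two: "\<exists>x\<in>M. \<exists>y\<in>M. x \<noteq> y"
    and walks: "\<And>x y. x \<in> M \<Longrightarrow> y \<in> M \<Longrightarrow> \<exists>k p. p 0 = x \<and> p k = y \<and>
      (\<forall>i<k. concave_pair M d (p i) (p (Suc i))) \<and> d x y = (\<Sum>i<k. d (p i) (p (Suc i)))"
  shows "prague_space M d"
proof -
  have sub: "E_ext M d \<subseteq> M \<times> M" by (auto simp: E_ext_def)
  have walks': "\<exists>k p. p 0 = x \<and> p k = y \<and>
      (\<forall>i<k. (p i, p (Suc i)) \<in> E_ext M d) \<and> d x y = (\<Sum>i<k. d (p i) (p (Suc i)))"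
    if xy: "x \<in> M" "y \<in> M" for x y
  proof -
    obtain k p where "p 0 = x" "p k = y" "\<forall>i<k. concave_pair M d (p i) (p (Suc i))"
      "d x y = (\<Sum>i<k. d (p i) (p (Suc i)))" using walks[OF xy] by blast
    then show ?thesis using concave_pair_E_ext by (intro exI[of _ k] exI[of _ p]) simp
  qed
  have "M \<subseteq> V_ext M d"
  proof
    fix x assume x: "x \<in> M"
    obtain y where y: "y \<in> M" "x \<noteq> y" using two by metis
    obtain k p where p: "p 0 = x" "p k = y" "\<forall>i<k. (p i, p (Suc i)) \<in> E_ext M d"
      using walks'[OF x y(1)] by blast
    then have "k > 0" using y by (cases k) auto
    then show "x \<in> V_ext M d" using p by (auto simp: V_ext_def Field_def)
  qed
  moreover have "V_ext M d \<subseteq> M" using sub by (auto simp: V_ext_def Field_def)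
  ultimately have V: "V_ext M d = M" by blast
  have conn: "graph_connected M (E_ext M d)"
    unfolding graph_connected_def
  proof (intro ballI)
    fix x y assume "x \<in> M" "y \<in> M"
    then obtain k p where p: "p 0 = x" "p k = y" "\<forall>i<k. (p i, p (Suc i)) \<in> E_ext M d"
      using walks' by blast
    have "(p 0, p i) \<in> (E_ext M d \<inter> M \<times> M)\<^sup>*" if "i \<le> k" for i
      using that
    proof (induction i)
      case (Suc i)
      then have "(p i, p (Suc i)) \<in> E_ext M d" using p(3) by simp
      then have "(p i, p (Suc i)) \<in> E_ext M d \<inter> M \<times> M" using sub by blast
      with Suc show ?case by (simp add: rtrancl_into_rtrancl)
    qed simp
    then show "(x, y) \<in> (E_ext M d \<inter> M \<times> M)\<^sup>*" using p(1,2) by blast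
  qed
  have inf: "d x y = Inf {\<Sum>i<k. d (p i) (p (Suc i)) | k p.
      p 0 = x \<and> p k = y \<and> (\<forall>i<k. (p i, p (Suc i)) \<in> E_ext M d)}"
    if xy: "x \<in> M" "y \<in> M" for x y
  proof (rule sym, rule cInf_eq_minimum)
    show "d x y \<in> {\<Sum>i<k. d (p i) (p (Suc i)) | k p.
      p 0 = x \<and> p k = y \<and> (\<forall>i<k. (p i, p (Suc i)) \<in> E_ext M d)}"
      using walks'[OF xy] by blast
    fix s assume "s \<in> {\<Sum>i<k. d (p i) (p (Suc i)) | k p.
      p 0 = x \<and> p k = y \<and> (\<forall>i<k. (p i, p (Suc i)) \<in> E_ext M d)}"
    then obtain k p where p: "s = (\<Sum>i<k. d (p i) (p (Suc i)))" "p 0 = x" "p k = y"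
      "\<forall>i<k. (p i, p (Suc i)) \<in> E_ext M d" by blast
    have "d (p 0) (p k) \<le> (\<Sum>i<k. d (p i) (p (Suc i)))"
      using p sub xy by (intro dist_le_walk) auto
    then show "d x y \<le> s" using p by simp
  qed
  have "mtopology closure_of M = M"
    by (metis closure_of_topspace topspace_mtopology)
  then show ?thesis
    unfolding prague_space_def V using Metric_space_axioms conn inf by blast
qed

lemma concave_pair_of_uniformly_concave:
  assumes "uniformly_concave M d" "x \<in> M" "y \<in> M" "x \<noteq> y"
  shows "concave_pair M d x y"
  unfolding concave_pair_def
proof (intro conjI allI impI assms(2-4))
  fix \<epsilon> :: real assume "\<epsilon> > 0"
  then obtain \<delta> where "\<delta> > 0" "\<forall>z\<in>M. min (d x z) (d y z) \<ge> \<epsilon> \<longrightarrow> d x z + d z y - \<delta> > d x y"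
    using assms unfolding uniformly_concave_def by meson
  then show "\<exists>\<delta>>0. \<forall>z\<in>M. min (d x z) (d y z) \<ge> \<epsilon> \<longrightarrow> d x z + d z y \<ge> d x y + \<delta>"
    by (intro exI[of _ \<delta>]) force
qed

end

section \<open>The graph metric\<close>

lemma relpow_symD: "sym E \<Longrightarrow> (x, y) \<in> E ^^ k \<Longrightarrow> (y, x) \<in> E ^^ k"
proof (induction k arbitrary: x y)
  case (Suc k)
  then obtain z where "(x, z) \<in> E ^^ k" "(z, y) \<in> E" by auto
  then have "(y, z) \<in> E" "(z, x) \<in> E ^^ k" using Suc by (auto dest: symD)
  then show ?case by (rule relpow_Suc_I2)
qed simp

lemma graph_dist_walk:
  assumes "graph_connected V E" "x \<in> V" "y \<in> V"
  shows "\<exists>k. graph_dist E x y = real k \<and> (x, y) \<in> E ^^ k"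
proof -
  have "(x, y) \<in> E\<^sup>*"
    using assms rtrancl_mono[of "E \<inter> V \<times> V" E] by (auto simp: graph_connected_def)
  then obtain k where "(x, y) \<in> E ^^ k" by (auto simp: rtrancl_power)
  then have "(x, y) \<in> E ^^ (LEAST k. (x, y) \<in> E ^^ k)" by (rule LeastI)
  then show ?thesis by (auto simp: graph_dist_def)
qed

lemma graph_dist_le: "(x, y) \<in> E ^^ k \<Longrightarrow> graph_dist E x y \<le> real k"
  by (simp add: graph_dist_def Least_le)

lemma Metric_space_graph_dist:
  assumes "simple_graph V E" "graph_connected V E"
  shows "Metric_space V (graph_dist E)"
proof
  have sym: "sym E" using assms by (simp add: simple_graph_def)
  show "0 \<le> graph_dist E x y" for x y by (simp add: graph_dist_def)
  show "graph_dist E x y = graph_dist E y x" for x y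
  proof -
    have "(x, y) \<in> E ^^ k \<longleftrightarrow> (y, x) \<in> E ^^ k" for k using relpow_symD[OF sym] by blast
    then show ?thesis by (simp add: graph_dist_def)
  qed
  show "graph_dist E x y = 0 \<longleftrightarrow> x = y" if xy: "x \<in> V" "y \<in> V" for x y
  proof
    assume "graph_dist E x y = 0"
    then show "x = y" using graph_dist_walk[OF assms(2) xy] by auto
  next
    assume "x = y"
    then have "graph_dist E x y \<le> real 0" by (intro graph_dist_le) simp
    then show "graph_dist E x y = 0" by (simp add: graph_dist_def)
  qed
  show "graph_dist E x z \<le> graph_dist E x y + graph_dist E y z"
    if xyz: "x \<in> V" "y \<in> V" "z \<in> V" for x y z
  proof -
    obtain k l where "graph_dist E x y = real k" "(x, y) \<in> E ^^ k"
      "graph_dist E y z = real l" "(y, z) \<in> E ^^ l"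
      using graph_dist_walk[OF assms(2) xyz(1,2)] graph_dist_walk[OF assms(2) xyz(2,3)] by blast
    moreover from this have "(x, z) \<in> E ^^ (k + l)" by (auto simp: relpow_add)
    ultimately show ?thesis using graph_dist_le by fastforce
  qed
qed

lemma graph_dist_ge_1:
  assumes "simple_graph V E" "graph_connected V E" "x \<in> V" "y \<in> V" "x \<noteq> y"
  shows "graph_dist E x y \<ge> 1"
proof -
  obtain k where k: "graph_dist E x y = real k" "(x, y) \<in> E ^^ k"
    using graph_dist_walk[OF assms(2-4)] by blast
  then show ?thesis using assms(5) by (cases k) auto
qed

lemma graph_dist_edge:
  assumes "simple_graph V E" "graph_connected V E" "(x, y) \<in> E"
  shows "graph_dist E x y = 1"
proof (rule antisym)
  have "x \<in> V" "y \<in> V" "x \<noteq> y" using assms by (auto simp: simple_graph_def irrefl_def)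
  then show "1 \<le> graph_dist E x y" by (rule graph_dist_ge_1[OF assms(1,2)])
  show "graph_dist E x y \<le> 1" using graph_dist_le[where k = 1] assms(3) by simp
qed

text \<open>
  A third vertex has distance at least 1 from both ends, so the detour exceeds the edge by at least 1.
\<close>

lemma concave_pair_graph_edge:
  assumes G: "simple_graph V E" "graph_connected V E" and e: "(x, y) \<in> E"
  shows "concave_pair V (graph_dist E) x y"
  unfolding concave_pair_def
proof (intro conjI allI impI)
  interpret Metric_space V "graph_dist E" by (rule Metric_space_graph_dist[OF G])
  show V: "x \<in> V" "y \<in> V" "x \<noteq> y" using G e by (auto simp: simple_graph_def irrefl_def)
  fix \<epsilon> :: real assume eps: "\<epsilon> > 0"
  have "graph_dist E x z + graph_dist E z y \<ge> graph_dist E x y + 1"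
    if z: "z \<in> V" "min (graph_dist E x z) (graph_dist E y z) \<ge> \<epsilon>" for z
  proof -
    have "x \<noteq> z" "z \<noteq> y" using z eps V by auto
    then have "graph_dist E x z \<ge> 1" "graph_dist E z y \<ge> 1"
      using graph_dist_ge_1[OF G] V z(1) by blast+
    then show ?thesis using graph_dist_edge[OF G e] by linarith
  qed
  then show "\<exists>\<delta>>0. \<forall>z\<in>V. min (graph_dist E x z) (graph_dist E y z) \<ge> \<epsilon> \<longrightarrow>
      graph_dist E x z + graph_dist E z y \<ge> graph_dist E x y + \<delta>"
    by (intro exI[of _ 1]) auto
qed

lemma mcomplete_graph_dist:
  assumes G: "simple_graph V E" "graph_connected V E"
  shows "Metric_space.mcomplete V (graph_dist E)"
proof -
  interpret Metric_space V "graph_dist E" by (rule Metric_space_graph_dist[OF G])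
  show ?thesis
    unfolding mcomplete_def
  proof (intro allI impI)
    fix \<sigma> assume c: "MCauchy \<sigma>"
    then have V: "\<sigma> n \<in> V" for n by (auto simp: MCauchy_def)
    have "\<exists>N. \<forall>n n'. N \<le> n \<longrightarrow> N \<le> n' \<longrightarrow> graph_dist E (\<sigma> n) (\<sigma> n') < 1"
      using c zero_less_one unfolding MCauchy_def by blast
    then obtain N where N: "\<And>n n'. N \<le> n \<Longrightarrow> N \<le> n' \<Longrightarrow> graph_dist E (\<sigma> n) (\<sigma> n') < 1"
      by blast
    have eq: "\<sigma> n = \<sigma> N" if "N \<le> n" for n
      using N[OF that order_refl] graph_dist_ge_1[OF G V V, of n N] by fastforce
    have "limitin mtopology \<sigma> (\<sigma> N) sequentially"
      unfolding limit_metric_sequentially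
    proof (intro conjI allI impI V exI)
      fix \<epsilon> :: real and n assume "\<epsilon> > 0" "N \<le> n"
      then show "graph_dist E (\<sigma> n) (\<sigma> N) < \<epsilon>" using eq[of n] V by simp
    qed
    then show "\<exists>x. limitin mtopology \<sigma> x sequentially" by blast
  qed
qed

lemma graph_dist_geodesic:
  assumes G: "simple_graph V E" "graph_connected V E" and xy: "x \<in> V" "y \<in> V"
  shows "\<exists>k p. p 0 = x \<and> p k = y \<and> (\<forall>i<k. (p i, p (Suc i)) \<in> E) \<and>
    graph_dist E x y = (\<Sum>i<k. graph_dist E (p i) (p (Suc i)))"
proof -
  obtain k where k: "graph_dist E x y = real k" "(x, y) \<in> E ^^ k"
    using graph_dist_walk[OF G(2) xy] by blast
  then obtain p where p: "p 0 = x" "p k = y" "\<forall>i<k. (p i, p (Suc i)) \<in> E"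
    by (auto simp: relpow_fun_conv)
  have "(\<Sum>i<k. graph_dist E (p i) (p (Suc i))) = (\<Sum>i<k. 1)"
    using p(3) graph_dist_edge[OF G] by (intro sum.cong) auto
  then show ?thesis using p k by (intro exI[of _ k] exI[of _ p]) simp
qed

section \<open>Uniformly concave spaces and graphs\<close>

theorem corollary4p11:
  fixes M :: "'a set" and d :: "'a \<Rightarrow> 'a \<Rightarrow> real"
    and V :: "'b set" and E :: "('b \<times> 'b) set"
  shows "(Metric_space M d \<and> (\<exists>x\<in>M. \<exists>y\<in>M. x \<noteq> y) \<and> uniformly_concave M d \<longrightarrow>
            prague_space M d \<and>
            (Metric_space.mcomplete M d \<longrightarrow> lipschitz_free_rigid M d)) \<and>
         (simple_graph V E \<and> (\<exists>x\<in>V. \<exists>y\<in>V. x \<noteq> y) \<and> n_connected 3 V E \<longrightarrow>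
            prague_space V (graph_dist E) \<and> lipschitz_free_rigid V (graph_dist E))"
proof (intro conjI impI)
  assume *: "Metric_space M d \<and> (\<exists>x\<in>M. \<exists>y\<in>M. x \<noteq> y) \<and> uniformly_concave M d"
  then interpret Metric_space M d by blast
  have two: "\<exists>x\<in>M. \<exists>y\<in>M. x \<noteq> y" using * by blast
  have cp: "concave_pair M d x y" if "x \<in> M" "y \<in> M" "x \<noteq> y" for x y
    using * concave_pair_of_uniformly_concave that by blast
  show "prague_space M d"
  proof (rule prague_space_of_concave_walks[OF two])
    fix x y assume xy: "x \<in> M" "y \<in> M"
    show "\<exists>k p. p 0 = x \<and> p k = y \<and>
      (\<forall>i<k. concave_pair M d (p i) (p (Suc i))) \<and> d x y = (\<Sum>i<k. d (p i) (p (Suc i)))"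
    proof (cases "x = y")
      case True
      then show ?thesis using xy by (intro exI[of _ 0] exI[of _ "\<lambda>_. x"]) simp
    next
      case False
      then show ?thesis
        using cp xy by (intro exI[of _ 1] exI[of _ "\<lambda>i. if i = 0 then x else y"]) simp
    qed
  qed
  let ?K = "{(x, y). x \<in> M \<and> y \<in> M \<and> x \<noteq> y}"
  have "simple_graph M ?K" by (auto simp: simple_graph_def sym_def irrefl_def)
  moreover have "n_connected 3 M ?K"
    unfolding n_connected_def graph_connected_def
  proof (intro allI impI ballI)
    fix S x y assume "x \<in> M - S" "y \<in> M - S"
    then show "(x, y) \<in> (?K \<inter> (M - S) \<times> (M - S))\<^sup>*" by (cases "x = y") auto
  qed
  moreover have "?K \<subseteq> {(x, y). concave_pair M d x y}" using cp by blast
  moreover assume mcomplete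
  ultimately show "lipschitz_free_rigid M d"
    using rigid_of_3_connected_concave_graph two by blast
next
  assume *: "simple_graph V E \<and> (\<exists>x\<in>V. \<exists>y\<in>V. x \<noteq> y) \<and> n_connected 3 V E"
  then have G: "simple_graph V E" "n_connected 3 V E" and two: "\<exists>x\<in>V. \<exists>y\<in>V. x \<noteq> y" by blast+
  have conn: "graph_connected V E"
    using G(2)[unfolded n_connected_def, rule_format, of "{}"] by simp
  interpret Metric_space V "graph_dist E" by (rule Metric_space_graph_dist[OF G(1) conn])
  have cp: "E \<subseteq> {(x, y). concave_pair V (graph_dist E) x y}"
    using concave_pair_graph_edge[OF G(1) conn] by blast
  show "prague_space V (graph_dist E)"
  proof (rule prague_space_of_concave_walks[OF two])
    fix x y assume "x \<in> V" "y \<in> V"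
    then obtain k p where "p 0 = x" "p k = y" "\<forall>i<k. (p i, p (Suc i)) \<in> E"
      "graph_dist E x y = (\<Sum>i<k. graph_dist E (p i) (p (Suc i)))"
      using graph_dist_geodesic[OF G(1) conn] by blast
    then show "\<exists>k p. p 0 = x \<and> p k = y \<and> (\<forall>i<k. concave_pair V (graph_dist E) (p i) (p (Suc i))) \<and>
        graph_dist E x y = (\<Sum>i<k. graph_dist E (p i) (p (Suc i)))"
      using concave_pair_graph_edge[OF G(1) conn] by (intro exI[of _ k] exI[of _ p]) simp
  qed
  show "lipschitz_free_rigid V (graph_dist E)"
    by (rule rigid_of_3_connected_concave_graph[OF mcomplete_graph_dist[OF G(1) conn] G cp two])
qed

end
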